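(* Let $\vec\kappa=\langle\kappa_0\le\dots\le\kappa_n\rangle$ be a weakly increasing tuple of cardinals, $0\le k\le n$ an integer, and suppose there exist $B\in[n+1]^{k+1}$ and a continuous map $\phi: X(\vec\kappa^B)\to Z^k(\vec\kappa|_B)$ such that (1) $\phi(\vec x)$ is a top coboundary for $\vec\kappa|_B$ for every $\vec x\in X(\vec\kappa^B)$ other than $(\infty,\dots,\infty)$, and (2) $\phi(\infty,\dots,\infty)$ is not a top coboundary for $\vec\kappa|_B$. Then $H^k(X(\vec\kappa)^-,\underline{\mathbb{Z}_2})\neq0$.
   Context: For a cardinal $\kappa$, $\alpha(\kappa)=\kappa\sqcup\{\infty\}$ is the one-point compactification of the discrete space $\kappa$. For a tuple $\vec\mu=\langle\mu_0,\dots,\mu_m\rangle$ of cardinals, $X(\vec\mu)=\prod_{i\le m}\alpha(\mu_i)$ (product topology; for $m=-1$ this is a one-point space) and $X(\vec\mu)^-=X(\vec\mu)\setminus\{(\infty,\dots,\infty)\}$. $H^k(Y,\underline{\mathbb{Z}_2})$ is sheaf cohomology with constant coefficients $\mathbb{Z}/2\mathbb{Z}$. $[n+1]^{k+1}$ is the set of $(k+1)$-element subsets of $\{0,\dots,n\}$. For $B\subseteq\{0,\dots,n\}$, $\vec\kappa|_B=\langle\kappa_i:i\in B\rangle$ and $\vec\kappa^B=\langle\kappa_i:i\notin B\rangle$. For a tuple $\vec\mu=\langle\mu_0,\dots,\mu_m\rangle$ and $A\subseteq\{0,\dots,m\}$, let $\mathcal{D}_A(\vec\mu)=\{\vec x\in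 X(\vec\mu):x_i\ne\infty\ \forall i\in A\}$. $Z^m(\vec\mu)$ denotes the set of all functions $\prod_{i\le m}\mu_i\to\mathbb{Z}_2$ (the top cocycles), topologized as the product $\mathbb{Z}_2^{\prod_i\mu_i}$ of discrete spaces (pointwise convergence). Such a function $f$ is a top coboundary for $\vec\mu$ if $f=\sum_{i\le m} g_i|_{\prod_j\mu_j}$ for some continuous functions $g_i:\mathcal{D}_{\{0,\dots,m\}\setminus\{i\}}(\vec\mu)\to\mathbb{Z}_2$ ($\mathbb{Z}_2$ discrete). *)

theory Defs
  imports
    "HOL-Analysis.Analysis"
    "HOL-Algebra.Coset"
    "HOL-Algebra.Product_Groups"
    "HOL-Library.Equipollence"
    "HOL-Library.Z2"
begin

section \<open>Sheaf cohomology with constant coefficients\<close>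

text \<open>
  Sheaf cohomology is defined as the cohomology of the global sections of Godement's canonical
  resolution. For a presheaf \<open>F\<close> let \<open>(C\<^sup>0 F)(U) = (\<Prod>x\<in>U. F\<^sub>x)\<close> be the product of the stalks; the
  resolution of \<open>A\<close> is given by \<open>Z\<^sup>0 = A\<close>, \<open>C\<^sup>n = C\<^sup>0 Z\<^sup>n\<close> and \<open>Z\<^sup>n\<^sup>+\<^sup>1 = coker (Z\<^sup>n \<rightarrow> C\<^sup>n)\<close>, the
  differential being the composite \<open>C\<^sup>n \<rightarrow> Z\<^sup>n\<^sup>+\<^sup>1 \<rightarrow> C\<^sup>n\<^sup>+\<^sup>1\<close>. (Since \<open>C\<^sup>0\<close> only depends on stalks, it is
  immaterial whether \<open>Z\<^sup>n\<close> is sheafified.)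

  The iterated products of stalks would need a new type for every \<open>n\<close>. To stay within one
  type, the stalks of all \<open>Z\<^sup>n\<close> are presented as quotients of the group of functions
  \<open>'a list \<Rightarrow> 'r\<close>, in which only the values on lists of length \<open>n\<close> matter for \<open>Z\<^sup>n\<close>.
  The function \<open>s\<close> stands for the constant section \<open>s []\<close> if \<open>n = 0\<close>, and in degree \<open>Suc n\<close>
  the function \<open>f\<close> stands for the class, modulo sections of \<open>Z\<^sup>n\<close>, of the section of \<open>C\<^sup>n\<close>
  whose value at the point \<open>x\<close> is the element of the stalk of \<open>Z\<^sup>n\<close> at \<open>x\<close> represented by
  \<open>\<lambda>l. f (x # l)\<close>. Each germ is represented in this way, because sections of \<open>C\<^sup>n\<close> are arbitrary
  families and extend by zero.
\<close>

definition list_fun_group :: "('a list \<Rightarrow> 'r::ab_group_add) monoid" where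
  "list_fun_group = \<lparr>carrier = UNIV, mult = (\<lambda>f g l. f l + g l), one = (\<lambda>l. 0)\<rparr>"

text \<open>The representatives of zero in the stalk of \<open>Z\<^sup>n\<close> at \<open>x\<close>: in degree \<open>Suc n\<close>, those whose
  germ at \<open>x\<close> is the germ of (the family of germs of) a section of \<open>Z\<^sup>n\<close>.\<close>

primrec stalk_null :: "'a topology \<Rightarrow> nat \<Rightarrow> 'a \<Rightarrow> ('a list \<Rightarrow> 'r::ab_group_add) set" where
  "stalk_null Y 0 x = {s. s [] = 0}"
| "stalk_null Y (Suc n) x =
     {f. \<exists>V s. openin Y V \<and> x \<in> V \<and> (\<forall>y\<in>V. (\<lambda>l. f (y # l) - s l) \<in> stalk_null Y n y)}"

definition godement_stalk :: "'a topology \<Rightarrow> nat \<Rightarrow> 'a \<Rightarrow> ('a list \<Rightarrow> 'r::ab_group_add) set monoid" where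
  "godement_stalk Y n x = list_fun_group Mod stalk_null Y n x"

text \<open>The sections of \<open>C\<^sup>n\<close> over \<open>U\<close>.\<close>

definition godement_sections ::
  "'a topology \<Rightarrow> nat \<Rightarrow> 'a set \<Rightarrow> ('a \<Rightarrow> ('a list \<Rightarrow> 'r::ab_group_add) set) monoid" where
  "godement_sections Y n U = product_group U (godement_stalk Y n)"

text \<open>The value of the differential of \<open>c\<close> at \<open>y\<close> is the class of the germ of \<open>c\<close> at \<open>y\<close>, as an
  element of the stalk of \<open>Z\<^sup>n\<^sup>+\<^sup>1\<close>. Here \<open>c x\<close> is a coset of \<open>stalk_null Y n x\<close>, so the membership
  condition says that \<open>f\<close> represents the section \<open>c\<close> plus the section \<open>s\<close> of \<open>Z\<^sup>n\<close> near \<open>y\<close>.\<close>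

definition godement_diff ::
  "'a topology \<Rightarrow> nat \<Rightarrow> 'a set \<Rightarrow> ('a \<Rightarrow> ('a list \<Rightarrow> 'r::ab_group_add) set)
     \<Rightarrow> ('a \<Rightarrow> ('a list \<Rightarrow> 'r) set)" where
  "godement_diff Y n U c =
     (\<lambda>y\<in>U. {f. \<exists>V s. openin Y V \<and> y \<in> V \<and> V \<subseteq> U \<and> (\<forall>x\<in>V. (\<lambda>l. f (x # l) - s l) \<in> c x)})"

definition godement_cocycles ::
  "'a topology \<Rightarrow> nat \<Rightarrow> ('a \<Rightarrow> ('a list \<Rightarrow> 'r::ab_group_add) set) set" where
  "godement_cocycles Y n =
     kernel (godement_sections Y n (topspace Y)) (godement_sections Y (Suc n) (topspace Y))
       (godement_diff Y n (topspace Y))"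

definition godement_coboundaries ::
  "'a topology \<Rightarrow> nat \<Rightarrow> ('a \<Rightarrow> ('a list \<Rightarrow> 'r::ab_group_add) set) set" where
  "godement_coboundaries Y n =
     (case n of
        0 \<Rightarrow> {\<one>\<^bsub>godement_sections Y 0 (topspace Y)\<^esub>}
      | Suc m \<Rightarrow> godement_diff Y m (topspace Y) ` carrier (godement_sections Y m (topspace Y)))"

definition sheaf_cohomology ::
  "'a topology \<Rightarrow> nat \<Rightarrow> ('a \<Rightarrow> ('a list \<Rightarrow> 'r::ab_group_add) set) set monoid" where
  "sheaf_cohomology Y n =
     (godement_sections Y n (topspace Y)) \<lparr>carrier := godement_cocycles Y n\<rparr>
       Mod godement_coboundaries Y n"

definition sheaf_cohomology_Z2 ::
  "'a topology \<Rightarrow> nat \<Rightarrow> ('a \<Rightarrow> ('a list \<Rightarrow> bit) set) set monoid" where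
  "sheaf_cohomology_Z2 Y n = sheaf_cohomology Y n"

text \<open>The remaining facts of this section confirm that this is a resolution by (evidently
  flabby) sheaves and that the cohomology groups are abelian groups.\<close>

lemma comm_group_list_fun_group: "comm_group (list_fun_group :: ('a list \<Rightarrow> 'r::ab_group_add) monoid)"
  unfolding list_fun_group_def
proof (rule comm_groupI, simp_all add: algebra_simps)
  show "\<exists>y. (\<lambda>l. x l + y l) = (\<lambda>l. 0)" for x :: "'a list \<Rightarrow> 'r"
    by (rule exI[of _ "\<lambda>l. - x l"]) simp
qed

lemma list_fun_group_simps [simp]:
  "carrier list_fun_group = UNIV"
  "mult list_fun_group = (\<lambda>f g l. f l + g l)"
  "one list_fun_group = (\<lambda>l. 0)"
  by (auto simp: list_fun_group_def)

lemma inv_list_fun_group [simp]: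
  "inv\<^bsub>list_fun_group\<^esub> f = (\<lambda>l. - f l :: 'r::ab_group_add)"
proof -
  interpret comm_group "list_fun_group :: ('a list \<Rightarrow> 'r::ab_group_add) monoid"
    by (rule comm_group_list_fun_group)
  show ?thesis by (rule inv_equality) auto
qed

lemma stalk_null_SucI:
  assumes "openin Y V" "x \<in> V" "\<And>y. y \<in> V \<Longrightarrow> (\<lambda>l. f (y # l) - s l) \<in> stalk_null Y n y"
  shows "f \<in> stalk_null Y (Suc n) x"
  unfolding stalk_null.simps mem_Collect_eq
  by (rule exI[of _ V], rule exI[of _ s]) (intro conjI ballI assms)

lemma stalk_null_SucE:
  assumes "f \<in> stalk_null Y (Suc n) x"
  obtains V s where "openin Y V" "x \<in> V" "\<forall>y\<in>V. (\<lambda>l. f (y # l) - s l) \<in> stalk_null Y n y"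
proof -
  from assms have "\<exists>V s. openin Y V \<and> x \<in> V \<and> (\<forall>y\<in>V. (\<lambda>l. f (y # l) - s l) \<in> stalk_null Y n y)"
    unfolding stalk_null.simps mem_Collect_eq .
  then show thesis by (elim exE conjE) (rule that)
qed

declare stalk_null.simps(2) [simp del]

lemma zero_in_stalk_null:
  "x \<in> topspace Y \<Longrightarrow> (\<lambda>l. 0 :: 'r::ab_group_add) \<in> stalk_null Y n x"
proof (induction n arbitrary: x)
  case (Suc n)
  then show ?case
    by (intro stalk_null_SucI[of Y "topspace Y" x _ "\<lambda>l. 0"]) simp_all
qed simp

lemma diff_in_stalk_null:
  fixes f g :: "'a list \<Rightarrow> 'r::ab_group_add"
  shows "f \<in> stalk_null Y n x \<Longrightarrow> g \<in> stalk_null Y n x \<Longrightarrow> (\<lambda>l. f l - g l) \<in> stalk_null Y n x"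
proof (induction n arbitrary: x f g)
  case (Suc n)
  obtain V s where V: "openin Y V" "x \<in> V" "\<forall>y\<in>V. (\<lambda>l. f (y # l) - s l) \<in> stalk_null Y n y"
    using Suc.prems(1) by (rule stalk_null_SucE)
  obtain W t where W: "openin Y W" "x \<in> W" "\<forall>y\<in>W. (\<lambda>l. g (y # l) - t l) \<in> stalk_null Y n y"
    using Suc.prems(2) by (rule stalk_null_SucE)
  have "(\<lambda>l. f (y # l) - g (y # l) - (s l - t l)) \<in> stalk_null Y n y" if "y \<in> V \<inter> W" for y
  proof -
    have "(\<lambda>l. (f (y # l) - s l) - (g (y # l) - t l)) \<in> stalk_null Y n y"
      using that by (intro Suc.IH V(3)[rule_format] W(3)[rule_format]) auto
    moreover have "(\<lambda>l. (f (y # l) - s l) - (g (y # l) - t l)) = (\<lambda>l. f (y # l) - g (y # l) - (s l - t l))"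
      by (simp add: fun_eq_iff)
    ultimately show ?thesis by simp
  qed
  with V(1,2) W(1,2) show ?case
    by (intro stalk_null_SucI[of Y "V \<inter> W" x _ "\<lambda>l. s l - t l"]) auto
qed simp

lemma subgroup_stalk_null:
  assumes "x \<in> topspace Y"
  shows "subgroup (stalk_null Y n x :: ('a list \<Rightarrow> 'r::ab_group_add) set) list_fun_group"
proof -
  have neg: "(\<lambda>l. - g l) \<in> stalk_null Y n x" if "g \<in> stalk_null Y n x" for g :: "'a list \<Rightarrow> 'r"
    using diff_in_stalk_null[OF zero_in_stalk_null[OF assms] that] by simp
  show ?thesis
  proof
    fix f g :: "'a list \<Rightarrow> 'r" assume "f \<in> stalk_null Y n x" "g \<in> stalk_null Y n x"
    then show "f \<otimes>\<^bsub>list_fun_group\<^esub> g \<in> stalk_null Y n x"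
      using diff_in_stalk_null[OF _ neg, of f g] by simp
  qed (auto intro: neg zero_in_stalk_null[OF assms])
qed

lemma comm_group_godement_stalk:
  assumes "x \<in> topspace Y"
  shows "comm_group (godement_stalk Y n x :: ('a list \<Rightarrow> 'r::ab_group_add) set monoid)"
  unfolding godement_stalk_def
  by (rule comm_group.abelian_FactGroup[OF comm_group_list_fun_group subgroup_stalk_null[OF assms]])

lemma comm_group_godement_sections:
  assumes "U \<subseteq> topspace Y"
  shows "comm_group (godement_sections Y n U :: ('a \<Rightarrow> ('a list \<Rightarrow> 'r::ab_group_add) set) monoid)"
proof -
  have st: "comm_group (godement_stalk Y n x :: ('a list \<Rightarrow> 'r) set monoid)" if "x \<in> U" for x
    by (rule comm_group_godement_stalk[OF subsetD[OF assms that]])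
  interpret group "godement_sections Y n U :: ('a \<Rightarrow> ('a list \<Rightarrow> 'r) set) monoid"
    unfolding godement_sections_def by (rule product_group) (rule comm_group.axioms(2)[OF st])
  show ?thesis
  proof (rule group_comm_groupI)
    fix c d :: "'a \<Rightarrow> ('a list \<Rightarrow> 'r) set"
    assume "c \<in> carrier (godement_sections Y n U)" "d \<in> carrier (godement_sections Y n U)"
    then show "c \<otimes>\<^bsub>godement_sections Y n U\<^esub> d = d \<otimes>\<^bsub>godement_sections Y n U\<^esub> c"
      unfolding godement_sections_def mult_product_group carrier_product_group
      by (intro restrict_ext comm_monoid.m_comm[OF comm_group.axioms(1)[OF st]]) auto
  qed
qed

definition godement_class ::
  "'a topology \<Rightarrow> nat \<Rightarrow> 'a set \<Rightarrow> ('a list \<Rightarrow> 'r::ab_group_add) \<Rightarrow> ('a \<Rightarrow> ('a list \<Rightarrow> 'r) set)" where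
  "godement_class Y n U f = (\<lambda>x\<in>U. stalk_null Y n x #>\<^bsub>list_fun_group\<^esub> (\<lambda>l. f (x # l)))"

lemma in_stalk_coset_iff:
  "g \<in> stalk_null Y n x #>\<^bsub>list_fun_group\<^esub> f \<longleftrightarrow> (\<lambda>l. g l - f l :: 'r::ab_group_add) \<in> stalk_null Y n x"
proof
  assume "(\<lambda>l. g l - f l) \<in> stalk_null Y n x"
  then show "g \<in> stalk_null Y n x #>\<^bsub>list_fun_group\<^esub> f"
    unfolding r_coset_def by (auto intro!: bexI[of _ "\<lambda>l. g l - f l"])
qed (auto simp: r_coset_def)

lemma stalk_coset_eq_iff:
  fixes f g :: "'a list \<Rightarrow> 'r::ab_group_add"
  assumes "x \<in> topspace Y"
  shows "stalk_null Y n x #>\<^bsub>list_fun_group\<^esub> f = stalk_null Y n x #>\<^bsub>list_fun_group\<^esub> g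
     \<longleftrightarrow> (\<lambda>l. f l - g l) \<in> stalk_null Y n x"
proof -
  interpret comm_group "list_fun_group :: ('a list \<Rightarrow> 'r) monoid" by (rule comm_group_list_fun_group)
  note s = subgroup_stalk_null[OF assms, of n, where 'r='r]
  show ?thesis
    using repr_independence[OF _ _ s, of f g] repr_independenceD[OF s, of g f] s rcos_self[OF _ s, of f]
    by (auto simp: in_stalk_coset_iff)
qed

lemma carrier_godement_sections:
  assumes "U \<subseteq> topspace Y"
  shows "carrier (godement_sections Y n U :: ('a \<Rightarrow> ('a list \<Rightarrow> 'r::ab_group_add) set) monoid)
           = range (godement_class Y n U)"
proof (intro equalityI subsetI)
  fix c :: "'a \<Rightarrow> ('a list \<Rightarrow> 'r) set" assume c: "c \<in> carrier (godement_sections Y n U)"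
  then have "\<forall>x\<in>U. \<exists>h. c x = stalk_null Y n x #>\<^bsub>list_fun_group\<^esub> h"
    by (auto simp: godement_sections_def godement_stalk_def carrier_FactGroup PiE_def Pi_def)
  then obtain h where h: "\<forall>x\<in>U. c x = stalk_null Y n x #>\<^bsub>list_fun_group\<^esub> h x" by metis
  have "c = godement_class Y n U (\<lambda>l. h (hd l) (tl l))"
    using c h by (auto simp: godement_sections_def godement_class_def PiE_def extensional_def fun_eq_iff)
  then show "c \<in> range (godement_class Y n U)" by blast
qed (auto simp: godement_sections_def godement_class_def godement_stalk_def carrier_FactGroup)

lemma godement_diff_class:
  assumes "openin Y U"
  shows "godement_diff Y n U (godement_class Y n U f) = godement_class Y (Suc n) U (\<lambda>l. f (tl l))"
proof
  fix y
  show "godement_diff Y n U (godement_class Y n U f) y = godement_class Y (Suc n) U (\<lambda>l. f (tl l)) y"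
  proof (cases "y \<in> U")
    case True
    have swap: "(\<lambda>l. g (x # l) - s l - f (x # l)) = (\<lambda>l. g (x # l) - f (x # l) - s l)" for g s x
      by (simp add: fun_eq_iff algebra_simps)
    have *: "(\<exists>V s. openin Y V \<and> y \<in> V \<and> V \<subseteq> U \<and>
             (\<forall>x\<in>V. (\<lambda>l. g (x # l) - s l) \<in> godement_class Y n U f x)) \<longleftrightarrow>
          (\<lambda>l. g l - f l) \<in> stalk_null Y (Suc n) y" (is "?L \<longleftrightarrow> ?R") for g
    proof
      assume ?L
      then obtain V s where V: "openin Y V" "y \<in> V" "V \<subseteq> U"
        and *: "\<forall>x\<in>V. (\<lambda>l. g (x # l) - s l) \<in> godement_class Y n U f x" by blast
      have "(\<lambda>l. g (x # l) - f (x # l) - s l) \<in> stalk_null Y n x" if "x \<in> V" for x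
      proof -
        have "(\<lambda>l. g (x # l) - s l - f (x # l)) \<in> stalk_null Y n x"
          using *[rule_format, OF that] V(3) that by (auto simp: godement_class_def in_stalk_coset_iff)
        then show ?thesis by (simp only: swap)
      qed
      then show ?R by (rule stalk_null_SucI[OF V(1,2)])
    next
      assume ?R
      then obtain V s where V: "openin Y V" "y \<in> V"
        and *: "\<forall>x\<in>V. (\<lambda>l. g (x # l) - f (x # l) - s l) \<in> stalk_null Y n x"
        by (rule stalk_null_SucE)
      have "(\<lambda>l. g (x # l) - s l) \<in> godement_class Y n U f x" if "x \<in> V \<inter> U" for x
        using *[rule_format, of x] that by (simp add: godement_class_def in_stalk_coset_iff swap)
      then show ?L using V True assms
        by (intro exI[of _ "V \<inter> U"] exI[of _ s]) auto
    qed
    have "godement_diff Y n U (godement_class Y n U f) y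
            = stalk_null Y (Suc n) y #>\<^bsub>list_fun_group\<^esub> f"
      by (rule Set.set_eqI) (simp only: godement_diff_def restrict_apply True if_True mem_Collect_eq * in_stalk_coset_iff)
    then show ?thesis using True by (simp add: godement_class_def)
  qed (simp add: godement_diff_def godement_class_def)
qed

lemma godement_class_mult:
  assumes "U \<subseteq> topspace Y"
  shows "godement_class Y n U f \<otimes>\<^bsub>godement_sections Y n U\<^esub> godement_class Y n U g
           = godement_class Y n U (\<lambda>l. f l + g l :: 'r::ab_group_add)"
proof -
  have "stalk_null Y n x \<lhd> (list_fun_group :: ('a list \<Rightarrow> 'r) monoid)" if "x \<in> U" for x
    by (rule comm_group.subgroup_imp_normal[OF comm_group_list_fun_group])
       (rule subgroup_stalk_null[OF subsetD[OF assms that]])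
  from normal.rcos_sum[OF this] show ?thesis
    by (simp add: godement_sections_def godement_stalk_def godement_class_def cong: restrict_cong)
qed

lemma godement_diff_hom:
  assumes "openin Y U"
  shows "godement_diff Y n U \<in> hom (godement_sections Y n U)
           (godement_sections Y (Suc n) U :: ('a \<Rightarrow> ('a list \<Rightarrow> 'r::ab_group_add) set) monoid)"
  using openin_subset[OF assms]
  by (auto simp: hom_def carrier_godement_sections godement_diff_class[OF assms] godement_class_mult)

lemma godement_class_eq_one_iff:
  assumes "U \<subseteq> topspace Y"
  shows "godement_class Y n U f = \<one>\<^bsub>godement_sections Y n U\<^esub>
     \<longleftrightarrow> (\<forall>x\<in>U. (\<lambda>l. f (x # l) :: 'r::ab_group_add) \<in> stalk_null Y n x)"
proof -
  interpret comm_group "list_fun_group :: ('a list \<Rightarrow> 'r) monoid" by (rule comm_group_list_fun_group)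
  have "stalk_null Y n x #>\<^bsub>list_fun_group\<^esub> (\<lambda>l. 0 :: 'r) = stalk_null Y n x" for x
    using coset_mult_one[of "stalk_null Y n x"] by simp
  then have "stalk_null Y n x #>\<^bsub>list_fun_group\<^esub> (\<lambda>l. f (x # l)) = stalk_null Y n x
      \<longleftrightarrow> (\<lambda>l. f (x # l)) \<in> stalk_null Y n x" if "x \<in> U" for x
    using stalk_coset_eq_iff[of x Y n "\<lambda>l. f (x # l)" "\<lambda>l. 0"] subsetD[OF assms that] by simp
  moreover have "restrict p U = restrict q U \<longleftrightarrow> (\<forall>x\<in>U. p x = q x)" for p q :: "'a \<Rightarrow> ('a list \<Rightarrow> 'r) set"
    by (metis restrict_apply' restrict_ext)
  ultimately show ?thesis
    by (simp add: godement_sections_def godement_stalk_def godement_class_def)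
qed

lemma godement_class_kernel_iff:
  assumes "openin Y U"
  shows "godement_diff Y n U (godement_class Y n U f) = \<one>\<^bsub>godement_sections Y (Suc n) U\<^esub>
     \<longleftrightarrow> (\<forall>x\<in>U. (f :: 'a list \<Rightarrow> 'r::ab_group_add) \<in> stalk_null Y (Suc n) x)"
  using godement_class_eq_one_iff[OF openin_subset[OF assms], of "Suc n" "\<lambda>l. f (tl l)"]
  by (simp add: godement_diff_class[OF assms])

lemma godement_diff_diff:
  assumes "openin Y U" "c \<in> carrier (godement_sections Y n U)"
  shows "godement_diff Y (Suc n) U (godement_diff Y n U c)
           = \<one>\<^bsub>godement_sections Y (Suc (Suc n)) U :: ('a \<Rightarrow> ('a list \<Rightarrow> 'r::ab_group_add) set) monoid\<^esub>"
proof -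
  obtain f where f: "c = godement_class Y n U f"
    using assms(2) unfolding carrier_godement_sections[OF openin_subset[OF assms(1)]] by (rule rangeE)
  have "(\<lambda>l. f (tl l)) \<in> stalk_null Y (Suc (Suc n)) x" if "x \<in> U" for x
    by (rule stalk_null_SucI[where V = U and s = f, OF assms(1) that])
       (simp add: zero_in_stalk_null subsetD[OF openin_subset[OF assms(1)]])
  then show ?thesis
    by (simp add: f godement_diff_class[OF assms(1), of n] godement_class_kernel_iff[OF assms(1)])
qed

lemma godement_locally_exact:
  fixes c :: "'a \<Rightarrow> ('a list \<Rightarrow> 'r::ab_group_add) set"
  assumes "openin Y U" "c \<in> carrier (godement_sections Y (Suc n) U)"
    and "godement_diff Y (Suc n) U c = \<one>\<^bsub>godement_sections Y (Suc (Suc n)) U\<^esub>" and "x \<in> U"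
  shows "\<exists>V b. openin Y V \<and> x \<in> V \<and> V \<subseteq> U \<and> b \<in> carrier (godement_sections Y n V) \<and>
           godement_diff Y n V b = restrict c V"
proof -
  obtain f where f: "c = godement_class Y (Suc n) U f"
    using assms(2) unfolding carrier_godement_sections[OF openin_subset[OF assms(1)]] by (rule rangeE)
  have "f \<in> stalk_null Y (Suc (Suc n)) x"
    using assms(3,4) unfolding f godement_class_kernel_iff[OF assms(1)] by (rule bspec)
  then obtain V s where V: "openin Y V" "x \<in> V"
    and s: "\<forall>y\<in>V. (\<lambda>l. f (y # l) - s l) \<in> stalk_null Y (Suc n) y"
    by (rule stalk_null_SucE)
  define W where "W = V \<inter> U"
  have W: "openin Y W" "x \<in> W" "W \<subseteq> U" "W \<subseteq> V" "W \<subseteq> topspace Y"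
    using V assms openin_subset[OF assms(1)] by (auto simp: W_def)
  have "godement_diff Y n W (godement_class Y n W s) y = restrict c W y" for y
  proof (cases "y \<in> W")
    case True
    then have "y \<in> V" "y \<in> U" "y \<in> topspace Y" using W by auto
    then have "stalk_null Y (Suc n) y #>\<^bsub>list_fun_group\<^esub> (\<lambda>l. f (y # l))
        = stalk_null Y (Suc n) y #>\<^bsub>list_fun_group\<^esub> s"
      using \<open>y \<in> V\<close> by (simp add: stalk_coset_eq_iff s[rule_format])
    then show ?thesis
      using True \<open>y \<in> U\<close> by (simp add: f godement_diff_class[OF W(1)] godement_class_def[of Y "Suc n"])
  qed (simp add: godement_diff_def)
  then have "godement_diff Y n W (godement_class Y n W s) = restrict c W" by (rule ext)
  then show ?thesis
    using W by (intro exI[of _ W] exI[of _ "godement_class Y n W s"])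
      (simp add: carrier_godement_sections)
qed

text \<open>The kernel in degree zero consists of the locally constant functions.\<close>

lemma godement_cocycles_zero:
  "godement_class Y 0 (topspace Y) f \<in> godement_cocycles Y 0 \<longleftrightarrow>
     (\<forall>x\<in>topspace Y. \<exists>V a. openin Y V \<and> x \<in> V \<and> (\<forall>y\<in>V. f [y] = (a :: 'r::ab_group_add)))"
proof -
  have "f \<in> stalk_null Y (Suc 0) x \<longleftrightarrow> (\<exists>V a. openin Y V \<and> x \<in> V \<and> (\<forall>y\<in>V. f [y] = a))" for x
  proof
    assume "f \<in> stalk_null Y (Suc 0) x"
    then obtain V s where "openin Y V" "x \<in> V" "\<forall>y\<in>V. (\<lambda>l. f (y # l) - s l) \<in> stalk_null Y 0 y"
      by (rule stalk_null_SucE)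
    then show "\<exists>V a. openin Y V \<and> x \<in> V \<and> (\<forall>y\<in>V. f [y] = a)"
      by (intro exI[of _ V] exI[of _ "s []"]) simp
  next
    assume "\<exists>V a. openin Y V \<and> x \<in> V \<and> (\<forall>y\<in>V. f [y] = a)"
    then obtain V a where V: "openin Y V" "x \<in> V" "\<forall>y\<in>V. f [y] = a" by blast
    then show "f \<in> stalk_null Y (Suc 0) x"
      by (intro stalk_null_SucI[OF V(1,2), of _ "\<lambda>_. a"]) simp
  qed
  then show ?thesis
    by (simp add: godement_cocycles_def kernel_def godement_class_kernel_iff carrier_godement_sections)
qed

lemma comm_group_sheaf_cohomology:
  "comm_group (sheaf_cohomology Y n :: ('a \<Rightarrow> ('a list \<Rightarrow> 'r::ab_group_add) set) set monoid)"
proof -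
  let ?G = "\<lambda>n. godement_sections Y n (topspace Y) :: ('a \<Rightarrow> ('a list \<Rightarrow> 'r) set) monoid"
  let ?Z = "godement_cocycles Y n :: ('a \<Rightarrow> ('a list \<Rightarrow> 'r) set) set"
  let ?B = "godement_coboundaries Y n :: ('a \<Rightarrow> ('a list \<Rightarrow> 'r) set) set"
  have G: "comm_group (?G n)" "group (?G n)" for n
    by (rule comm_group_godement_sections comm_group.axioms(2) order_refl)+
  have hom: "group_hom (?G n) (?G (Suc n)) (godement_diff Y n (topspace Y))" for n
    by (simp add: G godement_diff_hom group_hom.intro group_hom_axioms.intro)
  have Z: "subgroup ?Z (?G n)"
    unfolding godement_cocycles_def by (rule group_hom.subgroup_kernel[OF hom])
  have B: "subgroup ?B (?G n)"
    using group_hom.img_is_subgroup[OF hom] group.triv_subgroup[OF G(2)]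
    by (cases n) (simp_all add: godement_coboundaries_def)
  have "?B \<subseteq> ?Z"
  proof (cases n)
    case 0
    then show ?thesis using subgroup.one_closed[OF Z] by (simp add: godement_coboundaries_def)
  next
    case (Suc m)
    show ?thesis
    proof
      fix c assume c: "c \<in> ?B"
      then obtain b where b: "b \<in> carrier (?G m)" "c = godement_diff Y m (topspace Y) b"
        by (auto simp: godement_coboundaries_def Suc)
      moreover have "c \<in> carrier (?G n)" by (rule subgroup.mem_carrier[OF B c])
      ultimately show "c \<in> ?Z"
        using godement_diff_diff[OF openin_topspace b(1)]
        by (simp add: godement_cocycles_def kernel_def Suc)
    qed
  qed
  then have "subgroup ?B (?G n\<lparr>carrier := ?Z\<rparr>)"
    by (rule group.subgroup_incl[OF G(2) B Z])
  moreover have "comm_group (?G n\<lparr>carrier := ?Z\<rparr>)"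
    by (rule group.group_comm_groupI[OF subgroup.subgroup_is_group[OF Z G(2)]])
       (simp add: comm_monoid.m_comm[OF comm_group.axioms(1)[OF G(1)]] subgroup.mem_carrier[OF Z])
  ultimately show ?thesis
    unfolding sheaf_cohomology_def by (simp add: comm_group.abelian_FactGroup)
qed


section \<open>Products of one-point compactifications of discrete spaces\<close>

text \<open>
  A tuple of cardinals is given by sets \<open>K i\<close> of these cardinalities, \<open>i\<close> ranging over an index
  set \<open>I\<close>; subtuples are obtained by shrinking \<open>I\<close>, without renumbering. In \<^typ>\<open>'k option\<close> the
  point at infinity is \<^term>\<open>None\<close>. Elements of the product are functions extensional on \<open>I\<close>.
\<close>

definition X_space :: "(nat \<Rightarrow> 'k set) \<Rightarrow> nat set \<Rightarrow> (nat \<Rightarrow> 'k option) topology" where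
  "X_space K I = product_topology (\<lambda>i. Alexandroff_compactification (discrete_topology (K i))) I"

definition X_infinity :: "nat set \<Rightarrow> nat \<Rightarrow> 'k option" where
  "X_infinity I = (\<lambda>i\<in>I. None)"

definition X_punctured :: "(nat \<Rightarrow> 'k set) \<Rightarrow> nat set \<Rightarrow> (nat \<Rightarrow> 'k option) topology" where
  "X_punctured K I = subtopology (X_space K I) (topspace (X_space K I) - {X_infinity I})"

definition D_set :: "(nat \<Rightarrow> 'k set) \<Rightarrow> nat set \<Rightarrow> nat set \<Rightarrow> (nat \<Rightarrow> 'k option) set" where
  "D_set K I A = {x \<in> topspace (X_space K I). \<forall>i\<in>A. x i \<noteq> None}"

text \<open>The product of the \<open>K i\<close> is identified with the subset \<^term>\<open>D_set K I I\<close> of the space.\<close>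

definition top_cocycles :: "(nat \<Rightarrow> 'k set) \<Rightarrow> nat set \<Rightarrow> ((nat \<Rightarrow> 'k option) \<Rightarrow> bit) topology" where
  "top_cocycles K I = product_topology (\<lambda>_. discrete_topology UNIV) (D_set K I I)"

definition top_coboundary :: "(nat \<Rightarrow> 'k set) \<Rightarrow> nat set \<Rightarrow> ((nat \<Rightarrow> 'k option) \<Rightarrow> bit) \<Rightarrow> bool" where
  "top_coboundary K I f \<longleftrightarrow>
     (\<exists>g. (\<forall>i\<in>I. continuous_map (subtopology (X_space K I) (D_set K I (I - {i})))
                    (discrete_topology UNIV) (g i)) \<and>
          (\<forall>x\<in>D_set K I I. f x = (\<Sum>i\<in>I. g i x)))"

end

theory Submission
  imports Defs
begin

text \<open>
  The sets of points with a given coordinate finite cover the punctured product, and their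
  intersections are disjoint unions of compact zero-dimensional spaces, hence acyclic. So a Cech
  cocycle that is not a coboundary gives a nonzero class in Godement cohomology.

  Let \<open>p\<close> be the least index with \<open>\<kappa>\<^sub>p\<close> infinite and \<open>f = \<phi>(\<infinity>,\<dots>,\<infinity>)\<close>. Condition (2) forces
  \<open>p \<le> i\<close> for all \<open>i \<in> B\<close>. If \<open>p \<in> B\<close>, then \<open>f\<close> is itself a cocycle over the coordinates \<open>B\<close>.
  Otherwise let \<open>\<psi> a\<close> be the value of \<open>\<phi>\<close> at the point with \<open>p\<close>-th coordinate \<open>a\<close> and all others \<open>\<infinity>\<close>.
  For an injective sequence \<open>s\<close> in \<open>\<kappa>\<^sub>p\<close> the top coboundaries \<open>\<psi> (s (m + 1)) - \<psi> (s m)\<close>, indexed by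
  \<open>s m\<close> and converging to \<open>0\<close>, form a cocycle over the coordinates \<open>B \<union> {p}\<close>; were it a coboundary,
  telescoping would make \<open>f - \<psi> (s 0)\<close>, hence \<open>f\<close>, a top coboundary. In both cases the cocycle
  vanishes where the coordinate \<open>p\<close> is \<open>\<infinity>\<close>. Therefore it extends by zero off a diagonal to the
  remaining coordinates \<open>j > p\<close>, by means of injections \<open>\<kappa>\<^sub>p \<rightarrow> \<kappa>\<^sub>j\<close>, and to the finite coordinates
  \<open>j < p\<close> off their isolated points \<open>\<infinity>\<close>.

  The map \<open>\<phi>\<close> as a whole is not lifted to a cochain on the punctured product, since the coboundaries
  \<open>\<phi>(x)\<close> need not be decomposable continuously in \<open>x\<close>. For \<open>k = 0\<close> the cohomology group is nonzero
  just because the space is nonempty.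
\<close>

section \<open>Godement cohomology with coefficients in \<open>\<int>/2\<close>\<close>

declare add_bit_eq_xor [simp del]

lemma bit_add_self [simp]: "a + a = (0 :: bit)"
  by (cases a) (simp_all add: add_bit_eq_xor)

lemma bit_add_eq_0_iff: "a + b = 0 \<longleftrightarrow> a = (b :: bit)"
  by (cases a; cases b) simp_all

lemma bit_add_left_cancel [simp]: "a + (a + b) = (b :: bit)"
  by (simp flip: add.assoc)

lemma bit_add_cancel_middle: "(a + b) + (b + c) = a + (c :: bit)"
  by (simp add: add.assoc)

text \<open>Each unordered pair is counted twice and cancels in Z/2. This is what makes the Cech
  differential without signs square to zero.\<close>

lemma bit_sum_symmetric_eq_0:
  fixes f :: "'i \<Rightarrow> 'i \<Rightarrow> bit"
  assumes "finite A" "\<And>r s. f r s = f s r"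
  shows "(\<Sum>r\<in>A. \<Sum>s\<in>A - {r}. f r s) = 0"
  using assms(1)
proof (induction A rule: finite_induct)
  case (insert a A)
  have "(\<Sum>s\<in>insert a A - {r}. f r s) = f r a + (\<Sum>s\<in>A - {r}. f r s)" if "r \<in> A" for r
  proof -
    have "insert a A - {r} = insert a (A - {r})" using that insert.hyps by auto
    then show ?thesis using insert.hyps by simp
  qed
  then have "(\<Sum>r\<in>insert a A. \<Sum>s\<in>insert a A - {r}. f r s)
      = (\<Sum>s\<in>A. f a s) + (\<Sum>r\<in>A. f r a + (\<Sum>s\<in>A - {r}. f r s))"
    using insert.hyps by simp
  also have "\<dots> = 0"
    using insert.IH assms(2)[of a] by (simp add: sum.distrib)
  finally show ?case .
qed simp

text \<open>The recursion consumes one list entry per degree, so only lists of length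
  \<open>p\<close> are ever evaluated. Identities valid only for nonempty lists thus become
  usable.\<close>

lemma stalk_null_cong:
  assumes "\<And>l. length l = p \<Longrightarrow> f l = g l"
  shows "f \<in> stalk_null Y p x \<longleftrightarrow> g \<in> stalk_null Y p x"
  using assms
proof (induction p arbitrary: f g x)
  case (Suc p)
  have "(\<lambda>l. f (y # l) - s l) \<in> stalk_null Y p y \<longleftrightarrow> (\<lambda>l. g (y # l) - s l) \<in> stalk_null Y p y" for y s
    by (rule Suc.IH) (simp add: Suc.prems)
  then show ?case unfolding stalk_null.simps by simp
qed simp

lemma stalk_null_add:
  fixes f g :: "'a list \<Rightarrow> bit"
  shows "f \<in> stalk_null Y p x \<Longrightarrow> g \<in> stalk_null Y p x \<Longrightarrow> (\<lambda>l. f l + g l) \<in> stalk_null Y p x"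
  using diff_in_stalk_null[of f Y p x g] by simp

lemma stalk_null_sum:
  fixes f :: "'i \<Rightarrow> 'a list \<Rightarrow> bit"
  assumes "x \<in> topspace Y" "\<And>i. i \<in> A \<Longrightarrow> f i \<in> stalk_null Y p x"
  shows "(\<lambda>l. \<Sum>i\<in>A. f i l) \<in> stalk_null Y p x"
  using assms(2)
  by (induction A rule: infinite_finite_induct)
     (auto simp: zero_in_stalk_null[OF assms(1)] intro: stalk_null_add)

text \<open>The fibres of \<open>\<tau>\<close> partition \<open>U\<close> into relatively open sets
  refining the cover; the value of \<open>\<tau>\<close> names a member containing the
  fibre.\<close>

definition ultraparacompact_in :: "'a topology \<Rightarrow> 'a set \<Rightarrow> bool" where
  "ultraparacompact_in Y U \<longleftrightarrow>
     (\<forall>V. (\<forall>x\<in>U. openin Y (V x) \<and> x \<in> V x) \<longrightarrow>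
        (\<exists>\<tau>. \<forall>y\<in>U. \<tau> y \<in> U \<and> y \<in> V (\<tau> y) \<and> (\<exists>W. openin Y W \<and> y \<in> W \<and> (\<forall>z\<in>W. \<tau> z = \<tau> y))))"

text \<open>Local primitives can be glued along a partition without any correction, so that cocycles of
  positive degree are coboundaries.\<close>

lemma ultraparacompact_acyclic:
  fixes f :: "'a list \<Rightarrow> bit"
  assumes U: "ultraparacompact_in Y U" "U \<subseteq> topspace Y"
    and f: "\<And>x. x \<in> U \<Longrightarrow> f \<in> stalk_null Y (Suc (Suc p)) x"
  shows "\<exists>s. \<forall>x\<in>U. (\<lambda>l. f (x # l) + s l) \<in> stalk_null Y (Suc p) x"
proof -
  have "\<forall>x\<in>U. \<exists>V s. openin Y V \<and> x \<in> V \<and> (\<forall>y\<in>V. (\<lambda>l. f (y # l) + s l) \<in> stalk_null Y (Suc p) y)"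
    using f by (fastforce elim: stalk_null_SucE)
  then obtain V s where V: "\<And>x. x \<in> U \<Longrightarrow> openin Y (V x) \<and> x \<in> V x"
    and s: "\<And>x y. x \<in> U \<Longrightarrow> y \<in> V x \<Longrightarrow> (\<lambda>l. f (y # l) + s x l) \<in> stalk_null Y (Suc p) y"
    by metis
  from U(1)[unfolded ultraparacompact_in_def, rule_format, of V, OF V]
  obtain \<tau> where \<tau>: "\<forall>y\<in>U. \<tau> y \<in> U \<and> y \<in> V (\<tau> y) \<and>
      (\<exists>W. openin Y W \<and> y \<in> W \<and> (\<forall>z\<in>W. \<tau> z = \<tau> y))" ..
  \<comment> \<open>The head of the list is the point where the germ is taken, so near
    \<open>y\<close> this agrees with the single primitive \<open>s (\<tau> y)\<close>.\<close>
  define s' where "s' l = s (\<tau> (hd l)) l" for l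
  have "(\<lambda>l. f (y # l) + s' l) \<in> stalk_null Y (Suc p) y" if y: "y \<in> U" for y
  proof -
    obtain W where W: "openin Y W" "y \<in> W" "\<forall>z\<in>W. \<tau> z = \<tau> y" using bspec[OF \<tau> y] by blast
    have "(\<lambda>l. s (\<tau> y) l + s' l) \<in> stalk_null Y (Suc p) y"
    proof (rule stalk_null_SucI[OF W(1,2), of _ "\<lambda>_. 0"])
      fix z assume z: "z \<in> W"
      then have "z \<in> topspace Y" using openin_subset[OF W(1)] by blast
      with bspec[OF W(3) z] show "(\<lambda>l. s (\<tau> y) (z # l) + s' (z # l) - 0) \<in> stalk_null Y p z"
        by (simp add: s'_def zero_in_stalk_null)
    qed
    with s[of "\<tau> y" y] bspec[OF \<tau> y]
    have "(\<lambda>l. (f (y # l) + s (\<tau> y) l) + (s (\<tau> y) l + s' l)) \<in> stalk_null Y (Suc p) y"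
      by (intro stalk_null_add[of "\<lambda>l. f (y # l) + s (\<tau> y) l"]) (simp_all only: y)
    then show ?thesis by (simp only: bit_add_cancel_middle)
  qed
  then show ?thesis by (intro exI[of _ s'] ballI)
qed

text \<open>The differential of the class of \<open>g\<close> is represented at every point by
  \<open>g\<close> itself, so a primitive of the class of \<open>f\<close> is a function
  \<open>s\<close> of the stated kind.\<close>

lemma sheaf_cohomology_trivialD:
  fixes f :: "'a list \<Rightarrow> bit"
  assumes triv: "carrier (sheaf_cohomology_Z2 Y (Suc m)) = {\<one>\<^bsub>sheaf_cohomology_Z2 Y (Suc m)\<^esub>}"
    and f: "\<And>x. x \<in> topspace Y \<Longrightarrow> f \<in> stalk_null Y (Suc (Suc m)) x"
  shows "\<exists>s. \<forall>x\<in>topspace Y. (\<lambda>l. f (x # l) + s l) \<in> stalk_null Y (Suc m) x"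
proof -
  let ?G = "godement_sections Y (Suc m) (topspace Y) :: ('a \<Rightarrow> ('a list \<Rightarrow> bit) set) monoid"
  let ?Z = "godement_cocycles Y (Suc m) :: ('a \<Rightarrow> ('a list \<Rightarrow> bit) set) set"
  let ?B = "godement_coboundaries Y (Suc m) :: ('a \<Rightarrow> ('a list \<Rightarrow> bit) set) set"
  let ?f = "godement_class Y (Suc m) (topspace Y) f"
  interpret G: comm_group ?G by (rule comm_group_godement_sections) simp
  have "?f \<in> ?Z"
    by (simp add: godement_cocycles_def kernel_def carrier_godement_sections godement_class_kernel_iff f)
  then have "?B #>\<^bsub>?G\<lparr>carrier := ?Z\<rparr>\<^esub> ?f = ?B"
    using triv by (auto simp: sheaf_cohomology_Z2_def sheaf_cohomology_def carrier_FactGroup)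
  moreover have "\<one>\<^bsub>?G\<^esub> \<in> ?B"
  proof -
    have "godement_diff Y m (topspace Y) (godement_class Y m (topspace Y) (\<lambda>l. 0 :: bit)) = \<one>\<^bsub>?G\<^esub>"
      by (simp add: godement_class_kernel_iff zero_in_stalk_null)
    then show ?thesis
      unfolding godement_coboundaries_def nat.case by (intro image_eqI[where x = "godement_class Y m (topspace Y) (\<lambda>l. 0)"]) (simp_all add: carrier_godement_sections)
  qed
  moreover have "?f \<in> carrier ?G" by (simp add: carrier_godement_sections)
  \<comment> \<open>The coset of \<open>?f\<close> equals \<open>?B\<close>, and it contains
    \<open>?f\<close> because the neutral element lies in \<open>?B\<close>.\<close>
  ultimately have "?f \<in> ?B" by (force simp: r_coset_def)
  then obtain g where g: "?f = godement_class Y (Suc m) (topspace Y) (\<lambda>l. g (tl l))"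
    by (auto simp: godement_coboundaries_def carrier_godement_sections godement_diff_class)
  have "(\<lambda>l. f (x # l) + g l) \<in> stalk_null Y (Suc m) x" if x: "x \<in> topspace Y" for x
  proof -
    from fun_cong[OF g, of x] x
    have "stalk_null Y (Suc m) x #>\<^bsub>list_fun_group\<^esub> (\<lambda>l. f (x # l))
        = stalk_null Y (Suc m) x #>\<^bsub>list_fun_group\<^esub> g"
      by (simp add: godement_class_def)
    then show ?thesis using x by (simp add: stalk_coset_eq_iff)
  qed
  then show ?thesis by blast
qed

text \<open>The constant section 1 is a cocycle with nonzero germs, while zero is the only
  coboundary in degree 0.\<close>

lemma sheaf_cohomology_zero_nontrivial:
  assumes "topspace Y \<noteq> {}"
  shows "carrier (sheaf_cohomology_Z2 Y 0) \<noteq> {\<one>\<^bsub>sheaf_cohomology_Z2 Y 0\<^esub>}"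
proof
  let ?G = "godement_sections Y 0 (topspace Y) :: ('a \<Rightarrow> ('a list \<Rightarrow> bit) set) monoid"
  let ?Z = "godement_cocycles Y 0 :: ('a \<Rightarrow> ('a list \<Rightarrow> bit) set) set"
  let ?B = "godement_coboundaries Y 0 :: ('a \<Rightarrow> ('a list \<Rightarrow> bit) set) set"
  let ?f = "godement_class Y 0 (topspace Y) (\<lambda>l. 1 :: bit)"
  assume triv: "carrier (sheaf_cohomology_Z2 Y 0) = {\<one>\<^bsub>sheaf_cohomology_Z2 Y 0\<^esub>}"
  interpret G: comm_group ?G by (rule comm_group_godement_sections) simp
  have "?f \<in> ?Z" by (auto simp: godement_cocycles_zero)
  then have "?B #>\<^bsub>?G\<lparr>carrier := ?Z\<rparr>\<^esub> ?f = ?B"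
    using triv by (auto simp: sheaf_cohomology_Z2_def sheaf_cohomology_def carrier_FactGroup)
  moreover have "?B = {\<one>\<^bsub>?G\<^esub>}" by (simp add: godement_coboundaries_def)
  moreover have "?f \<in> carrier ?G" by (simp add: carrier_godement_sections)
  ultimately have "?f = \<one>\<^bsub>?G\<^esub>" by (force simp: r_coset_def)
  then show False using assms by (auto simp: godement_class_eq_one_iff)
qed

section \<open>Cech cochains\<close>

text \<open>If \<open>x\<close> lies in the member \<open>\<iota> x\<close> of the cover, then \<open>(h c) A x = c (insert (\<iota> x) A) x\<close> is a
  contracting homotopy for cochains with values in arbitrary functions. Iterating it gives the
  staircase in the Cech-Godement double complex explicitly: \<open>cech_lift \<iota> c A\<close> is its entry on
  the intersection indexed by \<open>A\<close>, and \<open>cech_lift \<iota> c {}\<close> is the Godement cocycle of \<open>c\<close>.\<close>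

fun cech_lift :: "('a \<Rightarrow> 'i) \<Rightarrow> ('i set \<Rightarrow> 'a \<Rightarrow> bit) \<Rightarrow> 'i set \<Rightarrow> 'a list \<Rightarrow> bit" where
  "cech_lift \<iota> c A [] = 0"
| "cech_lift \<iota> c A (x # l) =
     (if \<iota> x \<in> A then 0
      else if l = [] then c (insert (\<iota> x) A) x
      else cech_lift \<iota> c (insert (\<iota> x) A) l)"

text \<open>This is the homotopy identity \<open>d (h f) = f + h (d f)\<close> at \<open>A\<close>,
  where \<open>h f A\<close> is 0 if \<open>j \<in> A\<close> and \<open>f (insert j A)\<close>
  otherwise.\<close>

lemma sum_insert_Diff:
  fixes f :: "'i set \<Rightarrow> bit"
  assumes "finite A"
  shows "(\<Sum>r\<in>A. if j \<in> A - {r} then 0 else f (insert j (A - {r}))) =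
    (if j \<in> A then f A else f A + (\<Sum>r\<in>insert j A. f (insert j A - {r})))"
proof (cases "j \<in> A")
  case True
  \<comment> \<open>Removing any \<open>r\<close> other than \<open>j\<close> leaves
    \<open>j\<close> in the set, so only the term \<open>r = j\<close> survives.\<close>
  have "(\<Sum>r\<in>A. if j \<in> A - {r} then 0 else f (insert j (A - {r}))) = (\<Sum>r\<in>A. if r = j then f A else 0)"
    using True by (intro sum.cong) (auto simp: insert_absorb)
  then show ?thesis using True assms by simp
next
  case False
  have "(\<Sum>r\<in>A. if j \<in> A - {r} then 0 else f (insert j (A - {r}))) = (\<Sum>r\<in>A. f (insert j A - {r}))"
    using False by (intro sum.cong refl) (auto simp: insert_Diff_if)
  moreover have "insert j A - {j} = A" using False by simp
  ultimately show ?thesis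
    using False assms by (simp add: add_ac)
qed

lemma cech_lift_Cons:
  assumes "finite A" "l \<noteq> []"
  shows "(\<Sum>r\<in>A. cech_lift \<iota> c (A - {r}) (x # l)) + cech_lift \<iota> c A l =
    (if \<iota> x \<in> A then 0 else (\<Sum>r\<in>insert (\<iota> x) A. cech_lift \<iota> c (insert (\<iota> x) A - {r}) l))"
  unfolding cech_lift.simps if_not_P[OF assms(2)]
  unfolding sum_insert_Diff[OF assms(1), of "\<iota> x" "\<lambda>A. cech_lift \<iota> c A l"]
  by (simp add: add_ac)

text \<open>The end of the staircase: on one-point lists the homotopy identity is that of
  \<open>c\<close>, and the hypothesis removes its term with the differential of
  \<open>c\<close>.\<close>

lemma cech_lift_singleton:
  assumes "finite A" "\<iota> x \<notin> A \<Longrightarrow> (\<Sum>r\<in>insert (\<iota> x) A. c (insert (\<iota> x) A - {r}) x) = 0"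
  shows "(\<Sum>r\<in>A. cech_lift \<iota> c (A - {r}) [x]) = c A x"
  unfolding cech_lift.simps if_P[OF refl] sum_insert_Diff[OF assms(1), of "\<iota> x" "\<lambda>A. c A x"]
  using assms(2) by simp

declare cech_lift.simps [simp del]

definition cover_inter :: "'a topology \<Rightarrow> ('i \<Rightarrow> 'a set) \<Rightarrow> 'i set \<Rightarrow> 'a set" where
  "cover_inter Y U A = {x \<in> topspace Y. \<forall>i\<in>A. x \<in> U i}"

text \<open>Over Z/2 cochains may be indexed by sets, without order or signs. The selection \<iota>
  of a member of the cover at each point need not be continuous.\<close>

locale cech_cocycle =
  fixes Y :: "'a topology" and I :: "'i set" and U :: "'i \<Rightarrow> 'a set"
    and k :: nat and c :: "'i set \<Rightarrow> 'a \<Rightarrow> bit" and \<iota> :: "'a \<Rightarrow> 'i"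
  assumes finite_I: "finite I"
    and openin_U: "\<And>i. i \<in> I \<Longrightarrow> openin Y (U i)"
    and cover: "\<And>x. x \<in> topspace Y \<Longrightarrow> \<iota> x \<in> I \<and> x \<in> U (\<iota> x)"
    and loc_const: "\<And>A x. A \<subseteq> I \<Longrightarrow> card A = Suc k \<Longrightarrow> x \<in> cover_inter Y U A \<Longrightarrow>
        \<exists>W. openin Y W \<and> x \<in> W \<and> (\<forall>y\<in>W \<inter> cover_inter Y U A. c A y = c A x)"
    and cocycle: "\<And>A x. A \<subseteq> I \<Longrightarrow> card A = Suc (Suc k) \<Longrightarrow> x \<in> cover_inter Y U A \<Longrightarrow>
        (\<Sum>r\<in>A. c (A - {r}) x) = 0"
begin

abbreviation "b \<equiv> cech_lift \<iota> c"

abbreviation "cap \<equiv> cover_inter Y U"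

lemma finite_index: "A \<subseteq> I \<Longrightarrow> finite A"
  using finite_I finite_subset by blast

lemma cap_antimono: "A \<subseteq> B \<Longrightarrow> cap B \<subseteq> cap A"
  by (auto simp: cover_inter_def)

lemma cap_insert_cover: "x \<in> cap A \<Longrightarrow> A \<subseteq> I \<Longrightarrow> x \<in> cap (insert (\<iota> x) A) \<and> insert (\<iota> x) A \<subseteq> I"
  using cover[of x] by (auto simp: cover_inter_def)

lemma openin_cap:
  assumes "A \<subseteq> I"
  shows "openin Y (cap A)"
proof -
  have "cap A = (\<Inter>i\<in>A. U i) \<inter> topspace Y" by (auto simp: cover_inter_def)
  also have "openin Y \<dots>"
    using assms openin_U by (intro openin_INT finite_index) auto
  finally show ?thesis .
qed

text \<open>By the homotopy identity the sum is 0 or the Cech differential of \<open>b\<close> at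
  \<open>insert (\<iota> x) A\<close>, to which the first hypothesis applies. That hypothesis is
  kept explicit because it is the induction hypothesis of \<open>sum_cech_lift_null\<close>.\<close>

lemma cech_lift_step_aux:
  assumes "\<And>A x. A \<subseteq> I \<Longrightarrow> A \<noteq> {} \<Longrightarrow> card A + p = Suc k \<Longrightarrow> x \<in> cap A \<Longrightarrow>
      (\<lambda>l. \<Sum>r\<in>A. b (A - {r}) l) \<in> stalk_null Y (Suc p) x"
    and A: "A \<subseteq> I" "card A + Suc p = Suc k" "x \<in> cap A"
  shows "(\<lambda>l. (\<Sum>r\<in>A. b (A - {r}) (x # l)) + b A l) \<in> stalk_null Y (Suc p) x"
proof -
  let ?B = "insert (\<iota> x) A"
  have null: "(\<lambda>l. if \<iota> x \<in> A then 0 else (\<Sum>r\<in>?B. b (?B - {r}) l)) \<in> stalk_null Y (Suc p) x"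
  proof (cases "\<iota> x \<in> A")
    case True
    then show ?thesis using A(3) by (simp add: cover_inter_def zero_in_stalk_null)
  next
    case False
    then have "card ?B + p = Suc k" using A finite_index[OF A(1)] by simp
    then show ?thesis using assms(1)[of ?B x] cap_insert_cover[OF A(3,1)] False by simp
  qed
  \<comment> \<open>The homotopy identity fails for the empty list, hence the restriction on the
    length.\<close>
  have eq: "(\<Sum>r\<in>A. b (A - {r}) (x # l)) + b A l =
      (if \<iota> x \<in> A then 0 else (\<Sum>r\<in>?B. b (?B - {r}) l))" if "length l = Suc p" for l
    by (rule cech_lift_Cons[OF finite_index[OF A(1)]]) (use that in auto)
  show ?thesis by (rule iffD2[OF stalk_null_cong[OF eq] null])
qed

lemma sum_cech_lift_singleton:
  assumes "A \<subseteq> I" "card A = Suc k" "x \<in> cap A"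
  shows "(\<Sum>r\<in>A. b (A - {r}) [x]) = c A x"
proof (rule cech_lift_singleton[OF finite_index[OF assms(1)]])
  assume "\<iota> x \<notin> A"
  then show "(\<Sum>r\<in>insert (\<iota> x) A. c (insert (\<iota> x) A - {r}) x) = 0"
    using cocycle[of "insert (\<iota> x) A" x] cap_insert_cover[OF assms(3,1)] assms(2) finite_index[OF assms(1)]
    by simp
qed

text \<open>Along the staircase the Cech differential of \<open>b\<close> at \<open>A\<close> is the
  Godement differential of \<open>b A\<close>, which is therefore the witness. For
  \<open>p = 0\<close> it is \<open>c A\<close>, which is locally constant.\<close>

lemma sum_cech_lift_null:
  assumes "A \<subseteq> I" "A \<noteq> {}" "card A + p = Suc k" "x \<in> cap A"
  shows "(\<lambda>l. \<Sum>r\<in>A. b (A - {r}) l) \<in> stalk_null Y (Suc p) x"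
  using assms
proof (induction p arbitrary: A x)
  case 0
  have card: "card A = Suc k" using 0 by simp
  obtain W where W: "openin Y W" "x \<in> W" "\<forall>y\<in>W \<inter> cap A. c A y = c A x"
    using loc_const[OF 0(1) card 0(4)] by (elim exE conjE)
  show ?case
  proof (rule stalk_null_SucI[of Y "W \<inter> cap A" x _ "\<lambda>_. c A x"])
    fix y assume y: "y \<in> W \<inter> cap A"
    have "c A y = c A x" by (rule bspec[OF W(3) y])
    then show "(\<lambda>l. (\<Sum>r\<in>A. b (A - {r}) (y # l)) - c A x) \<in> stalk_null Y 0 y"
      using sum_cech_lift_singleton[of A y] y 0 by simp
  next
    show "openin Y (W \<inter> cap A)" using W(1) 0(1) by (intro openin_Int openin_cap)
    show "x \<in> W \<inter> cap A" using W(2) 0(4) by blast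
  qed
next
  case (Suc p)
  show ?case
  proof (rule stalk_null_SucI[of Y "cap A" x _ "b A"])
    fix y assume y: "y \<in> cap A"
    have "card A + Suc p = Suc k" using Suc.prems(3) .
    from cech_lift_step_aux[OF Suc.IH Suc.prems(1) this y]
    show "(\<lambda>l. (\<Sum>r\<in>A. b (A - {r}) (y # l)) - b A l) \<in> stalk_null Y (Suc p) y"
      unfolding minus_bit_def .
  next
    show "openin Y (cap A)" using Suc.prems(1) by (rule openin_cap)
  qed (rule Suc.prems(4))
qed

lemmas cech_lift_step = cech_lift_step_aux[OF sum_cech_lift_null]

text \<open>Near \<open>x\<close> the function \<open>b {}\<close> is the Cech differential of
  \<open>b\<close> at the singleton \<open>{\<iota> x}\<close>.\<close>

lemma cech_lift_cocycle:
  assumes "x \<in> topspace Y"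
  shows "b {} \<in> stalk_null Y (Suc k) x"
proof -
  have "(\<lambda>l. \<Sum>r\<in>{\<iota> x}. b ({\<iota> x} - {r}) l) \<in> stalk_null Y (Suc k) x"
    using cover[OF assms] assms by (intro sum_cech_lift_null) (auto simp: cover_inter_def)
  moreover have "(\<Sum>r\<in>{\<iota> x}. b ({\<iota> x} - {r}) l) = b {} l" for l by simp
  ultimately show ?thesis by (simp only:)
qed

text \<open>The staircase is descended again: \<open>t A\<close> is a section over \<open>cap A\<close> of the sheaf of cocycles
  and \<open>S A\<close> a primitive of it.\<close>

lemma cech_coboundary_descent:
  assumes acyclic: "\<And>A. A \<subseteq> I \<Longrightarrow> A \<noteq> {} \<Longrightarrow> ultraparacompact_in Y (cap A)"
    and s0: "\<And>x. x \<in> topspace Y \<Longrightarrow> (\<lambda>l. b {} (x # l) + s0 l) \<in> stalk_null Y k x"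
    and "q < k"
  shows "\<exists>t. (\<forall>A\<subseteq>I. card A = Suc q \<longrightarrow> (\<forall>x\<in>cap A. t A \<in> stalk_null Y (k - q) x)) \<and>
    (\<forall>A\<subseteq>I. card A = Suc (Suc q) \<longrightarrow> (\<forall>l. (\<Sum>r\<in>A. t (A - {r}) l) = (\<Sum>r\<in>A. b (A - {r}) l)))"
proof -
  \<comment> \<open>One step of the descent: \<open>t'\<close> is \<open>b\<close> plus the Cech
    differential of the primitives \<open>S\<close>. It is null because \<open>t\<close> and
    \<open>b\<close> have the same Cech differential, and it has the Cech differential of
    \<open>b\<close> because that of \<open>S\<close> is killed by a second one.\<close>
  have descend: "\<exists>t'. (\<forall>A\<subseteq>I. card A = Suc q \<longrightarrow> (\<forall>x\<in>cap A. t' A \<in> stalk_null Y (k - q) x)) \<and>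
    (\<forall>A\<subseteq>I. card A = Suc (Suc q) \<longrightarrow> (\<forall>l. (\<Sum>r\<in>A. t' (A - {r}) l) = (\<Sum>r\<in>A. b (A - {r}) l)))"
    if q: "q < k" and S: "\<And>A x. A \<subseteq> I \<Longrightarrow> card A = q \<Longrightarrow> x \<in> cap A \<Longrightarrow>
        (\<lambda>l. t A (x # l) + S A l) \<in> stalk_null Y (k - q) x"
      and t: "\<And>A l. A \<subseteq> I \<Longrightarrow> card A = Suc q \<Longrightarrow> (\<Sum>r\<in>A. t (A - {r}) l) = (\<Sum>r\<in>A. b (A - {r}) l)"
    for q :: nat and t S
  proof (intro exI[of _ "\<lambda>A l. b A l + (\<Sum>r\<in>A. S (A - {r}) l)"] conjI allI impI ballI)
    fix A x assume A: "A \<subseteq> I" "card A = Suc q" "x \<in> cap A"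
    have "(\<lambda>l. \<Sum>r\<in>A. t (A - {r}) (x # l) + S (A - {r}) l) \<in> stalk_null Y (k - q) x"
    proof (rule stalk_null_sum)
      fix r assume "r \<in> A"
      with A finite_index[OF A(1)] cap_antimono[of "A - {r}" A]
      show "(\<lambda>l. t (A - {r}) (x # l) + S (A - {r}) l) \<in> stalk_null Y (k - q) x"
        by (intro S) auto
    qed (use A(3) in \<open>simp add: cover_inter_def\<close>)
    moreover have "(\<lambda>l. (\<Sum>r\<in>A. b (A - {r}) (x # l)) + b A l) \<in> stalk_null Y (k - q) x"
      using cech_lift_step[of "k - Suc q" A x] A q by (simp add: Suc_diff_Suc)
    ultimately have "(\<lambda>l. (\<Sum>r\<in>A. t (A - {r}) (x # l) + S (A - {r}) l) +
        ((\<Sum>r\<in>A. b (A - {r}) (x # l)) + b A l)) \<in> stalk_null Y (k - q) x"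
      by (rule stalk_null_add)
    moreover have "(\<Sum>r\<in>A. t (A - {r}) (x # l) + S (A - {r}) l) + ((\<Sum>r\<in>A. b (A - {r}) (x # l)) + b A l)
        = b A l + (\<Sum>r\<in>A. S (A - {r}) l)" for l
      unfolding sum.distrib t[OF A(1,2)]
      by (simp add: add_ac)
    ultimately show "(\<lambda>l. b A l + (\<Sum>r\<in>A. S (A - {r}) l)) \<in> stalk_null Y (k - q) x"
      by (simp only:)
  next
    fix A l assume A: "A \<subseteq> I" "card A = Suc (Suc q)"
    have "(\<Sum>r\<in>A. \<Sum>s\<in>A - {r}. S (A - {r} - {s}) l) = 0"
      by (rule bit_sum_symmetric_eq_0[OF finite_index[OF A(1)]])
         (rule arg_cong[where f = "\<lambda>B. S B l"], blast)
    then show "(\<Sum>r\<in>A. b (A - {r}) l + (\<Sum>ra\<in>A - {r}. S (A - {r} - {ra}) l)) = (\<Sum>r\<in>A. b (A - {r}) l)"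
      by (simp add: sum.distrib)
  qed
  show ?thesis
    using \<open>q < k\<close>
  proof (induction q)
    case 0
    show ?case
    \<comment> \<open>The global primitive \<open>s0\<close> of \<open>b {}\<close> starts the
      descent, \<open>{}\<close> being the only finite index set of size 0.\<close>
    proof (rule descend[where t = b and S = "\<lambda>_. s0", OF 0])
      show "(\<lambda>l. b A (x # l) + s0 l) \<in> stalk_null Y (k - 0) x" if "A \<subseteq> I" "card A = 0" "x \<in> cap A" for A x
        using that s0[of x] finite_index[OF that(1)] by (simp add: cover_inter_def)
    qed simp
  next
    case (Suc q)
    from Suc.IH[OF Suc_lessD[OF Suc.prems]]
    obtain t where "(\<forall>A\<subseteq>I. card A = Suc q \<longrightarrow> (\<forall>x\<in>cap A. t A \<in> stalk_null Y (k - q) x)) \<and>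
      (\<forall>A\<subseteq>I. card A = Suc (Suc q) \<longrightarrow> (\<forall>l. (\<Sum>r\<in>A. t (A - {r}) l) = (\<Sum>r\<in>A. b (A - {r}) l)))" ..
    note t = conjunct1[OF this, rule_format] and tb = conjunct2[OF this, rule_format]
    have "\<forall>A. \<exists>s. A \<subseteq> I \<longrightarrow> card A = Suc q \<longrightarrow>
        (\<forall>x\<in>cap A. (\<lambda>l. t A (x # l) + s l) \<in> stalk_null Y (k - Suc q) x)"
    proof (rule allI, cases)
      fix A assume A: "A \<subseteq> I \<and> card A = Suc q"
      \<comment> \<open>Since \<open>Suc q < k\<close>, the degree \<open>k - q\<close> is at least
        2, as acyclicity requires.\<close>
      obtain m where m: "k - q = Suc (Suc m)" "k - Suc q = Suc m"
        using Suc.prems by (metis Suc_diff_Suc Suc_lessD)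
      have "\<exists>s. \<forall>x\<in>cap A. (\<lambda>l. t A (x # l) + s l) \<in> stalk_null Y (Suc m) x"
      proof (rule ultraparacompact_acyclic)
        show "ultraparacompact_in Y (cap A)" using A by (intro acyclic) auto
        show "t A \<in> stalk_null Y (Suc (Suc m)) x" if "x \<in> cap A" for x
          using t[of A x] that A m(1) by simp
      qed (simp add: cover_inter_def)
      then show "\<exists>s. A \<subseteq> I \<longrightarrow> card A = Suc q \<longrightarrow>
          (\<forall>x\<in>cap A. (\<lambda>l. t A (x # l) + s l) \<in> stalk_null Y (k - Suc q) x)"
        unfolding m(2) by (elim exE) (intro exI impI)
    qed blast
    from choice[OF this] obtain S where "\<forall>A. A \<subseteq> I \<longrightarrow> card A = Suc q \<longrightarrow>
        (\<forall>x\<in>cap A. (\<lambda>l. t A (x # l) + S A l) \<in> stalk_null Y (k - Suc q) x)" ..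
    note S = this[rule_format]
    from descend[where t = t and S = S, OF Suc.prems S tb] show ?case .
  qed
qed

text \<open>At the last stage \<open>q = k - 1\<close> the functions \<open>t A\<close> are null in
  degree 1, so their values on one-point lists are locally constant. These values are the primitive,
  because \<open>t\<close> and \<open>b\<close> have the same Cech differential, which is
  \<open>c\<close> on such lists.\<close>

theorem cech_coboundary:
  assumes triv: "carrier (sheaf_cohomology_Z2 Y k) = {\<one>\<^bsub>sheaf_cohomology_Z2 Y k\<^esub>}" and "k > 0"
    and acyclic: "\<And>A. A \<subseteq> I \<Longrightarrow> A \<noteq> {} \<Longrightarrow> ultraparacompact_in Y (cap A)"
  shows "\<exists>g. (\<forall>A\<subseteq>I. card A = k \<longrightarrow>
          (\<forall>x\<in>cap A. \<exists>W. openin Y W \<and> x \<in> W \<and> (\<forall>y\<in>W. g A y = g A x))) \<and>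
      (\<forall>A\<subseteq>I. card A = Suc k \<longrightarrow> (\<forall>x\<in>cap A. c A x = (\<Sum>r\<in>A. g (A - {r}) x)))"
proof -
  obtain m where m: "k = Suc m" using \<open>k > 0\<close> by (cases k) auto
  obtain s0 where "\<And>x. x \<in> topspace Y \<Longrightarrow> (\<lambda>l. b {} (x # l) + s0 l) \<in> stalk_null Y k x"
    using sheaf_cohomology_trivialD[of Y m "b {}"] cech_lift_cocycle triv unfolding m by blast
  from cech_coboundary_descent[OF acyclic this, of m]
  obtain t where t: "\<forall>A\<subseteq>I. card A = k \<longrightarrow> (\<forall>x\<in>cap A. t A \<in> stalk_null Y (Suc 0) x)"
    and tb: "\<forall>A\<subseteq>I. card A = Suc k \<longrightarrow> (\<forall>l. (\<Sum>r\<in>A. t (A - {r}) l) = (\<Sum>r\<in>A. b (A - {r}) l))"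
    by (auto simp: m)
  show ?thesis
  proof (intro exI[of _ "\<lambda>A x. t A [x]"] conjI allI impI ballI)
    fix A x assume A: "A \<subseteq> I" "card A = k" "x \<in> cap A"
    from t A have "t A \<in> stalk_null Y (Suc 0) x" by blast
    then obtain V s where "openin Y V" "x \<in> V" "\<forall>y\<in>V. (\<lambda>l. t A (y # l) - s l) \<in> stalk_null Y 0 y"
      by (rule stalk_null_SucE)
    then show "\<exists>W. openin Y W \<and> x \<in> W \<and> (\<forall>y\<in>W. t A [y] = t A [x])"
      by (intro exI[of _ V]) (simp add: bit_add_eq_0_iff)
  next
    fix A x assume A: "A \<subseteq> I" "card A = Suc k" "x \<in> cap A"
    show "c A x = (\<Sum>r\<in>A. t (A - {r}) [x])"
      using tb[rule_format, OF A(1,2), of "[x]"] sum_cech_lift_singleton[OF A] by simp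
  qed
qed

end

section \<open>Neighbourhoods in products of one-point compactifications\<close>

lemma topspace_X_space: "topspace (X_space K I) = (\<Pi>\<^sub>E i\<in>I. insert None (Some ` K i))"
  by (simp add: X_space_def)

lemma compact_space_X_space: "compact_space (X_space K I)"
  by (simp add: X_space_def compact_space_product_topology)

text \<open>For finite \<open>F\<close> this describes a basic neighbourhood of \<open>x\<close>.
  One exceptional set serves all coordinates, which costs nothing for finite
  \<open>I\<close>.\<close>

definition near :: "nat set \<Rightarrow> 'k set \<Rightarrow> (nat \<Rightarrow> 'k option) \<Rightarrow> (nat \<Rightarrow> 'k option) \<Rightarrow> bool" where
  "near I F x y \<longleftrightarrow> (\<forall>i\<in>I. if x i = None then y i \<notin> Some ` F else y i = x i)"

lemma near_refl [simp]: "near I F x x"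
  by (auto simp: near_def)

lemma near_mono: "near I F x y \<Longrightarrow> G \<subseteq> F \<Longrightarrow> near I G x y"
  by (fastforce simp: near_def split: if_splits)

lemma near_trans: "near I F x y \<Longrightarrow> near I F y z \<Longrightarrow> near I F x z"
  unfolding near_def by (metis option.discI imageE)

lemma near_Some: "near I F x y \<Longrightarrow> i \<in> I \<Longrightarrow> x i \<noteq> None \<Longrightarrow> y i = x i"
  by (auto simp: near_def)

lemma near_None: "near I F x y \<Longrightarrow> i \<in> I \<Longrightarrow> x i = None \<Longrightarrow> a \<in> F \<Longrightarrow> y i \<noteq> Some a"
  by (auto simp: near_def)

text \<open>Basic neighbourhoods are clopen: enlarging \<open>F\<close> by the finite coordinates of
  the centre \<open>x\<close> bounds how far membership can change. The set \<open>G\<close> is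
  independent of \<open>y\<close>.\<close>

lemma near_iff_of_near:
  assumes "near I G y z" "F \<subseteq> G" "the ` x ` I \<subseteq> G"
  shows "near I F x z \<longleftrightarrow> near I F x y"
proof -
  have "(if x i = None then z i \<notin> Some ` F else z i = x i)
      \<longleftrightarrow> (if x i = None then y i \<notin> Some ` F else y i = x i)" if i: "i \<in> I" for i
  proof (cases "y i")
    case None
    then have "z i \<notin> Some ` G" using assms(1) i by (auto simp: near_def)
    moreover have "x i \<noteq> None \<Longrightarrow> x i \<in> Some ` G" using assms(3) i by force
    ultimately show ?thesis using None assms(2) by auto
  next
    case (Some a)
    then have "z i = y i" using near_Some[OF assms(1) i] by simp
    then show ?thesis by simp
  qed
  then show ?thesis by (simp add: near_def)
qed

lemma openin_X_space_iff:
  assumes "finite I"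
  shows "openin (X_space K I) V \<longleftrightarrow> V \<subseteq> topspace (X_space K I) \<and>
    (\<forall>x\<in>V. \<exists>F. finite F \<and> (\<forall>y\<in>topspace (X_space K I). near I F x y \<longrightarrow> y \<in> V))"
    (is "?L \<longleftrightarrow> ?R")
proof
  assume L: ?L
  show ?R
  proof (intro conjI ballI)
    show "V \<subseteq> topspace (X_space K I)" using L by (rule openin_subset)
    fix x assume "x \<in> V"
    with L obtain U where U: "\<And>i. i \<in> I \<Longrightarrow> openin (Alexandroff_compactification (discrete_topology (K i))) (U i)"
      and x: "x \<in> Pi\<^sub>E I U" and sub: "Pi\<^sub>E I U \<subseteq> V"
      unfolding X_space_def openin_product_topology_alt by metis
    have "\<exists>F. finite F \<and> (x i = None \<longrightarrow> insert None (Some ` (K i - F)) \<subseteq> U i)" if i: "i \<in> I" for i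
    proof (cases "x i = None")
      case True
      then have "None \<in> U i" using x i by (auto simp: PiE_iff)
      \<comment> \<open>An open set containing \<infinity> is not one of those coming from the
        discrete space, so it has finite complement.\<close>
      then have "U i \<noteq> Some ` W" for W by auto
      then have "\<exists>C. finite C \<and> U i = insert None (Some ` (K i - C))"
        using U[OF i] unfolding openin_Alexandroff_compactification compactin_discrete_topology by force
      then show ?thesis by auto
    qed (intro exI[of _ "{}"], auto)
    then obtain F where F: "\<And>i. i \<in> I \<Longrightarrow> finite (F i)"
      "\<And>i. i \<in> I \<Longrightarrow> x i = None \<Longrightarrow> insert None (Some ` (K i - F i)) \<subseteq> U i" by metis
    have "y \<in> V" if y: "y \<in> topspace (X_space K I)" and near: "near I (\<Union>i\<in>I. F i) x y" for y
    proof -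
      have "y i \<in> U i" if i: "i \<in> I" for i
      proof (cases "x i = None")
        case True
        have "y i \<noteq> Some a" if "a \<in> F i" for a
          using that i by (intro near_None[OF near i True]) blast
        then have "y i \<notin> Some ` F i" by blast
        then have "y i \<in> insert None (Some ` (K i - F i))"
          using y i by (auto simp: topspace_X_space PiE_iff)
        then show ?thesis using F(2)[OF i True] by blast
      next
        case False
        then show ?thesis using near_Some[OF near i] x i by (simp add: PiE_iff)
      qed
      then have "y \<in> Pi\<^sub>E I U" using y by (simp add: topspace_X_space PiE_iff)
      with sub show ?thesis by blast
    qed
    then show "\<exists>F. finite F \<and> (\<forall>y\<in>topspace (X_space K I). near I F x y \<longrightarrow> y \<in> V)"
      using finite_UN_I[OF assms F(1)] by (intro exI[of _ "\<Union>i\<in>I. F i"] conjI ballI impI)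
  qed
next
  assume R: ?R
  show ?L
    unfolding X_space_def openin_product_topology_alt
  proof (intro ballI)
    fix x assume x: "x \<in> V"
    then obtain F where F: "finite F" "\<And>y. y \<in> topspace (X_space K I) \<Longrightarrow> near I F x y \<Longrightarrow> y \<in> V"
      using R by blast
    have xt: "x \<in> topspace (X_space K I)" using R x by blast
    define U where "U i = (if x i = None then insert None (Some ` (K i - F)) else {x i})" for i
    have "openin (Alexandroff_compactification (discrete_topology (K i))) (U i)" if i: "i \<in> I" for i
    proof (cases "x i")
      case None
      have "U i = insert None (Some ` (K i - (K i \<inter> F)))" using None by (auto simp: U_def)
      then show ?thesis
        unfolding openin_Alexandroff_compactification compactin_discrete_topology
        using F(1) by (intro disjI2 exI[of _ "K i \<inter> F"]) simp
    next
      case (Some a)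
      then have "a \<in> K i" using xt i by (auto simp: topspace_X_space PiE_iff)
      then have "openin (Alexandroff_compactification (discrete_topology (K i))) (Some ` {a})"
        by (subst openin_Alexandroff_compactification_image_Some) simp
      then show ?thesis using Some by (simp add: U_def)
    qed
    moreover have "x \<in> Pi\<^sub>E I U" using xt by (auto simp: U_def topspace_X_space PiE_iff)
    moreover have "Pi\<^sub>E I U \<subseteq> V"
    proof
      fix y assume y: "y \<in> Pi\<^sub>E I U"
      have "y i \<in> insert None (Some ` K i)" if i: "i \<in> I" for i
      proof -
        have "y i \<in> U i" using y i by (rule PiE_mem)
        then show ?thesis using xt i by (auto simp: U_def topspace_X_space PiE_iff split: if_splits)
      qed
      then have "y \<in> topspace (X_space K I)" using y by (simp add: topspace_X_space PiE_iff)
      moreover have "near I F x y" using y by (auto simp: near_def U_def PiE_iff split: if_splits)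
      ultimately show "y \<in> V" by (rule F(2))
    qed
    ultimately show "\<exists>U. finite {i \<in> I. U i \<noteq> topspace (Alexandroff_compactification (discrete_topology (K i)))} \<and>
        (\<forall>i\<in>I. openin (Alexandroff_compactification (discrete_topology (K i))) (U i)) \<and>
        x \<in> Pi\<^sub>E I U \<and> Pi\<^sub>E I U \<subseteq> V"
      using assms by (intro exI[of _ U] conjI ballI) simp_all
  qed
qed

lemma openin_near:
  assumes "finite I" "finite F"
  shows "openin (X_space K I) {y \<in> topspace (X_space K I). near I F x y}"
  unfolding openin_X_space_iff[OF assms(1)] using assms(2) by (auto intro!: exI[of _ F] intro: near_trans)

section \<open>Locally constant functions and top coboundaries\<close>

definition loc_const :: "nat set \<Rightarrow> (nat \<Rightarrow> 'k option) set \<Rightarrow> ((nat \<Rightarrow> 'k option) \<Rightarrow> 'b) \<Rightarrow> bool" where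
  "loc_const I U h \<longleftrightarrow> (\<forall>x\<in>U. \<exists>F. finite F \<and> (\<forall>y\<in>U. near I F x y \<longrightarrow> h y = h x))"

lemma loc_constD:
  assumes "loc_const I U h" "x \<in> U"
  obtains F where "finite F" "\<forall>y\<in>U. near I F x y \<longrightarrow> h y = h x"
  using assms unfolding loc_const_def by metis

lemma continuous_map_iff_loc_const:
  fixes h :: "(nat \<Rightarrow> 'k option) \<Rightarrow> 'b"
  assumes "finite I" "U \<subseteq> topspace (X_space K I)"
  shows "continuous_map (subtopology (X_space K I) U) (discrete_topology UNIV) h \<longleftrightarrow> loc_const I U h"
    (is "?L \<longleftrightarrow> ?R")
proof
  assume L: ?L
  show ?R
    unfolding loc_const_def
  proof
    fix x assume x: "x \<in> U"
    from L have "openin (subtopology (X_space K I) U) {y \<in> topspace (subtopology (X_space K I) U). h y \<in> {h x}}"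
      by (rule openin_continuous_map_preimage) simp
    then obtain T where T: "openin (X_space K I) T"
      "{y \<in> topspace (subtopology (X_space K I) U). h y \<in> {h x}} = T \<inter> U"
      by (auto simp: openin_subtopology)
    have eq: "{y \<in> U. h y = h x} = T \<inter> U" using T(2) assms(2) by auto
    then have "x \<in> T" using x by blast
    then obtain F where "finite F" "\<And>y. y \<in> topspace (X_space K I) \<Longrightarrow> near I F x y \<Longrightarrow> y \<in> T"
      using T(1) unfolding openin_X_space_iff[OF assms(1)] by metis
    then show "\<exists>F. finite F \<and> (\<forall>y\<in>U. near I F x y \<longrightarrow> h y = h x)"
      using eq assms(2) by blast
  qed
next
  assume R: ?R
  show ?L
    unfolding continuous_map_def
  proof (intro conjI allI impI)
    fix V :: "'b set"
    show "openin (subtopology (X_space K I) U) {x \<in> topspace (subtopology (X_space K I) U). h x \<in> V}"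
    proof (subst openin_subopen, intro ballI)
      fix x assume "x \<in> {x \<in> topspace (subtopology (X_space K I) U). h x \<in> V}"
      then have x: "x \<in> U" "x \<in> topspace (X_space K I)" "h x \<in> V" by auto
      obtain F where F: "finite F" "\<forall>y\<in>U. near I F x y \<longrightarrow> h y = h x"
        using R x(1) by (rule loc_constD)
      let ?T = "{y \<in> topspace (X_space K I). near I F x y} \<inter> U"
      have "openin (subtopology (X_space K I) U) ?T"
        using openin_near[OF assms(1) F(1)] by (auto simp: openin_subtopology)
      moreover have "?T \<subseteq> {x \<in> topspace (subtopology (X_space K I) U). h x \<in> V}"
      proof
        fix y assume y: "y \<in> ?T"
        then have "h y = h x" using F(2) by blast
        then show "y \<in> {x \<in> topspace (subtopology (X_space K I) U). h x \<in> V}" using y x(3) by auto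
      qed
      ultimately show "\<exists>T. openin (subtopology (X_space K I) U) T \<and> x \<in> T \<and>
          T \<subseteq> {x \<in> topspace (subtopology (X_space K I) U). h x \<in> V}"
        using x by (intro exI[of _ ?T]) auto
    qed
  qed simp
qed

lemma top_coboundary_iff:
  assumes "finite I"
  shows "top_coboundary K I f \<longleftrightarrow>
    (\<exists>g. (\<forall>i\<in>I. loc_const I (D_set K I (I - {i})) (g i)) \<and> (\<forall>x\<in>D_set K I I. f x = (\<Sum>i\<in>I. g i x)))"
proof -
  have "D_set K I A \<subseteq> topspace (X_space K I)" for A by (auto simp: D_set_def)
  then show ?thesis
    unfolding top_coboundary_def by (simp add: continuous_map_iff_loc_const[OF assms])
qed

lemma loc_const_combine:
  assumes "loc_const I U g" "loc_const I U h"
  shows "loc_const I U (\<lambda>x. c (g x) (h x))"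
  unfolding loc_const_def
proof
  fix x assume x: "x \<in> U"
  obtain F where F: "finite F" "\<forall>y\<in>U. near I F x y \<longrightarrow> g y = g x"
    using assms(1) x by (rule loc_constD)
  obtain G where G: "finite G" "\<forall>y\<in>U. near I G x y \<longrightarrow> h y = h x"
    using assms(2) x by (rule loc_constD)
  have "c (g y) (h y) = c (g x) (h x)" if "y \<in> U" "near I (F \<union> G) x y" for y
    using bspec[OF F(2) that(1)] bspec[OF G(2) that(1)] that(2) near_mono[of I "F \<union> G" x y] by simp
  then show "\<exists>F. finite F \<and> (\<forall>y\<in>U. near I F x y \<longrightarrow> c (g y) (h y) = c (g x) (h x))"
    using F(1) G(1) by (intro exI[of _ "F \<union> G"]) auto
qed

lemma top_coboundary_add:
  assumes "finite I" "top_coboundary K I f" "top_coboundary K I g"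
  shows "top_coboundary K I (\<lambda>x. f x + g x)"
proof -
  obtain u where u: "\<And>i. i \<in> I \<Longrightarrow> loc_const I (D_set K I (I - {i})) (u i)"
    "\<And>x. x \<in> D_set K I I \<Longrightarrow> f x = (\<Sum>i\<in>I. u i x)"
    using assms(2) unfolding top_coboundary_iff[OF assms(1)] by blast
  obtain v where v: "\<And>i. i \<in> I \<Longrightarrow> loc_const I (D_set K I (I - {i})) (v i)"
    "\<And>x. x \<in> D_set K I I \<Longrightarrow> g x = (\<Sum>i\<in>I. v i x)"
    using assms(3) unfolding top_coboundary_iff[OF assms(1)] by blast
  show ?thesis
    unfolding top_coboundary_iff[OF assms(1)]
  proof (intro exI[of _ "\<lambda>i x. u i x + v i x"] conjI ballI)
    show "loc_const I (D_set K I (I - {i})) (\<lambda>x. u i x + v i x)" if "i \<in> I" for i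
      using loc_const_combine[OF u(1)[OF that] v(1)[OF that], of "(+)"] .
  qed (simp add: u(2) v(2) sum.distrib)
qed

text \<open>In a finite factor \<open>\<infinity>\<close> is isolated, so that extension by zero in that factor is continuous.\<close>

lemma top_coboundary_if_finite:
  assumes "finite I" "i \<in> I" "finite (K i)"
  shows "top_coboundary K I f"
  unfolding top_coboundary_iff[OF assms(1)]
proof (intro exI[of _ "\<lambda>j x. if j = i \<and> x i \<noteq> None then f x else 0"] conjI ballI)
  fix j assume "j \<in> I"
  show "loc_const I (D_set K I (I - {j})) (\<lambda>x. if j = i \<and> x i \<noteq> None then f x else 0)"
    unfolding loc_const_def
  proof (intro ballI exI conjI impI)
    show "finite (K i)" by fact
    fix x y assume x: "x \<in> D_set K I (I - {j})" and y: "y \<in> D_set K I (I - {j})" and near: "near I (K i) x y"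
    have "y = x" if "j = i"
    proof (rule PiE_ext)
      show "y \<in> (\<Pi>\<^sub>E i\<in>I. insert None (Some ` K i))" "x \<in> (\<Pi>\<^sub>E i\<in>I. insert None (Some ` K i))"
        using x y by (auto simp: D_set_def topspace_X_space)
      fix l assume l: "l \<in> I"
      show "y l = x l"
      proof (cases "x l = None")
        case False then show ?thesis by (rule near_Some[OF near l])
      next
        case True
        moreover have "\<forall>l\<in>I - {i}. x l \<noteq> None" using x that by (simp add: D_set_def)
        ultimately have "l = i" using l by blast
        moreover have "y i \<in> insert None (Some ` K i)"
          using y assms(2) by (auto simp: D_set_def topspace_X_space PiE_iff)
        ultimately show ?thesis using near_None[OF near l True] True by auto
      qed
    qed
    then show "(if j = i \<and> y i \<noteq> None then f y else 0) = (if j = i \<and> x i \<noteq> None then f x else 0)" by auto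
  qed
next
  fix x assume "x \<in> D_set K I I"
  then have "x i \<noteq> None" using assms(2) by (auto simp: D_set_def)
  then have "(\<Sum>j\<in>I. if j = i \<and> x i \<noteq> None then f x else 0) = (\<Sum>j\<in>I. if j = i then f x else 0)"
    by (intro sum.cong) auto
  also have "\<dots> = f x" using assms by simp
  finally show "f x = (\<Sum>j\<in>I. if j = i \<and> x i \<noteq> None then f x else 0)" by simp
qed

section \<open>The punctured product and the acyclicity of its cover\<close>

lemma topspace_X_punctured: "topspace (X_punctured K I) = topspace (X_space K I) - {X_infinity I}"
  by (auto simp: X_punctured_def)

text \<open>The removed point is closed: any other point has a finite coordinate, which its
  neighbours share.\<close>

lemma openin_X_punctured_iff:
  assumes "finite I"
  shows "openin (X_punctured K I) V \<longleftrightarrow> openin (X_space K I) V \<and> X_infinity I \<notin> V"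
proof -
  have "openin (X_space K I) (topspace (X_space K I) - {X_infinity I})"
    unfolding openin_X_space_iff[OF assms]
  proof (intro conjI ballI)
    fix x assume x: "x \<in> topspace (X_space K I) - {X_infinity I}"
    have "\<not> near I {} x (X_infinity I)"
    proof
      assume n: "near I {} x (X_infinity I)"
      have "x = X_infinity I"
      proof
        fix i show "x i = X_infinity I i"
          using x near_Some[OF n, of i] by (cases "i \<in> I") (auto simp: X_infinity_def topspace_X_space PiE_iff extensional_def)
      qed
      with x show False by simp
    qed
    then show "\<exists>F. finite F \<and> (\<forall>y\<in>topspace (X_space K I). near I F x y \<longrightarrow> y \<in> topspace (X_space K I) - {X_infinity I})"
      by (intro exI[of _ "{}"]) auto
  qed simp
  then show ?thesis
    unfolding X_punctured_def using openin_subset[of "X_space K I" V]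
    by (auto simp: openin_open_subtopology)
qed

lemma openin_D_set:
  assumes "finite I" "A \<subseteq> I" "A \<noteq> {}"
  shows "openin (X_punctured K I) (D_set K I A)"
  unfolding openin_X_punctured_iff[OF assms(1)] openin_X_space_iff[OF assms(1)]
proof (intro conjI ballI exI)
  fix x y assume x: "x \<in> D_set K I A" and y: "y \<in> topspace (X_space K I)"
  show "near I {} x y \<longrightarrow> y \<in> D_set K I A"
    using x y assms(2) near_Some[of I "{}" x y] by (auto simp: D_set_def)
qed (use assms in \<open>auto simp: D_set_def X_infinity_def\<close>)

text \<open>Fixing the coordinates in \<open>A\<close> splits the set into clopen compact slices.
  Each slice is covered by finitely many clopen boxes subordinate to the cover, and a box is chosen
  depending only on which of them contain the point.\<close>

lemma ultraparacompact_D_set: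
  assumes "finite I" "A \<subseteq> I" "A \<noteq> {}"
  shows "ultraparacompact_in (X_punctured K I) (D_set K I A)"
  unfolding ultraparacompact_in_def
proof (intro allI impI)
  let ?X = "X_space K I" and ?D = "D_set K I A"
  fix V assume "\<forall>x\<in>?D. openin (X_punctured K I) (V x) \<and> x \<in> V x"
  then have "\<forall>x\<in>?D. \<exists>F. finite F \<and> (\<forall>y\<in>topspace ?X. near I F x y \<longrightarrow> y \<in> V x)"
    unfolding openin_X_punctured_iff[OF assms(1)] openin_X_space_iff[OF assms(1)] by simp
  from bchoice[OF this] obtain F where
    F0: "\<forall>x\<in>?D. finite (F x) \<and> (\<forall>y\<in>topspace ?X. near I (F x) x y \<longrightarrow> y \<in> V x)" ..
  then have F: "\<And>x. x \<in> ?D \<Longrightarrow> finite (F x)"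
    "\<And>x y. x \<in> ?D \<Longrightarrow> y \<in> topspace ?X \<Longrightarrow> near I (F x) x y \<Longrightarrow> y \<in> V x"
    by simp_all
  define N where "N x = {y \<in> topspace ?X. near I (F x) x y}" for x
  define E where "E a = {z \<in> ?D. restrict z A = a}" for a
  have "\<forall>a. \<exists>S. finite S \<and> S \<subseteq> E a \<and> E a \<subseteq> (\<Union>x\<in>S. N x)"
  proof
    fix a
    show "\<exists>S. finite S \<and> S \<subseteq> E a \<and> E a \<subseteq> (\<Union>x\<in>S. N x)"
    proof (cases "E a = {}")
      case False
      then obtain y where y: "y \<in> E a" by blast
      have "closedin ?X (E a)"
        \<comment> \<open>The member \<open>y\<close> supplies the values of the slice on
          \<open>A\<close>; a neighbourhood of \<open>z\<close> that avoids these values at infinite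
          coordinates meets the slice only if \<open>z\<close> lies in it.\<close>
        unfolding closedin_def openin_X_space_iff[OF assms(1)]
      proof (intro conjI ballI exI impI)
        fix z w assume z: "z \<in> topspace ?X - E a" and w: "w \<in> topspace ?X" "near I (the ` y ` I) z w"
        have "w \<notin> E a"
        proof
          assume w': "w \<in> E a"
          have r: "restrict w A = restrict y A" using w' y by (simp add: E_def)
          have "w i = y i" if "i \<in> A" for i
            using that fun_cong[OF r, of i] by simp
          then have "z i = y i" if "i \<in> A" for i
            using that near_Some[OF w(2), of i] near_None[OF w(2), of i "the (y i)"] assms(2) y
            by (cases "z i") (auto simp: E_def D_set_def)
          then have "z \<in> E a" using z y by (auto simp: E_def D_set_def)
          with z show False by simp
        qed
        with w(1) show "w \<in> topspace ?X - E a" by simp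
      qed (auto simp: E_def D_set_def assms(1))
      then have "compactin ?X (E a)"
        by (rule closedin_compact_space[OF compact_space_X_space])
      moreover have "openin ?X (N x)" if "x \<in> E a" for x
        unfolding N_def using that by (intro openin_near assms(1) F) (simp add: E_def)
      moreover have "E a \<subseteq> \<Union> (N ` E a)"
        by (auto simp: N_def E_def D_set_def)
      ultimately have "\<exists>\<F>. finite \<F> \<and> \<F> \<subseteq> N ` E a \<and> E a \<subseteq> \<Union>\<F>"
        unfolding compactin_def by (elim conjE allE[where x = "N ` E a"]) simp
      then obtain \<F> where \<F>: "finite \<F>" "\<F> \<subseteq> N ` E a" "E a \<subseteq> \<Union>\<F>" by blast
      from finite_subset_image[OF \<F>(1,2)] obtain S where "S \<subseteq> E a" "finite S" "\<F> = N ` S" by blast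
      then show ?thesis using \<F>(3) by (intro exI[of _ S]) simp
    qed auto
  qed
  from choice[OF this] obtain S where "\<forall>a. finite (S a) \<and> S a \<subseteq> E a \<and> E a \<subseteq> (\<Union>x\<in>S a. N x)" ..
  then have S: "\<And>a. finite (S a)" "\<And>a. S a \<subseteq> E a" "\<And>a. E a \<subseteq> (\<Union>x\<in>S a. N x)"
    by simp_all
  define P where "P y x \<longleftrightarrow> x \<in> S (restrict y A) \<and> near I (F x) x y" for x y
  \<comment> \<open>The choice depends on \<open>y\<close> only through the predicate
    \<open>P y\<close>, so \<tau> is locally constant as soon as \<open>P\<close> is.\<close>
  define \<tau> where "\<tau> y = (SOME x. P y x)" for y
  have \<tau>: "P y (\<tau> y)" if "y \<in> ?D" for y
  proof -
    have "y \<in> E (restrict y A)" using that by (simp add: E_def)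
    then have "\<exists>x. P y x" using S(3)[of "restrict y A"] by (auto simp: N_def P_def)
    then show ?thesis unfolding \<tau>_def by (rule someI_ex)
  qed
  show "\<exists>\<tau>. \<forall>y\<in>?D. \<tau> y \<in> ?D \<and> y \<in> V (\<tau> y) \<and>
      (\<exists>W. openin (X_punctured K I) W \<and> y \<in> W \<and> (\<forall>z\<in>W. \<tau> z = \<tau> y))"
  proof (intro exI[of _ \<tau>] ballI conjI)
    fix y assume y: "y \<in> ?D"
    show D: "\<tau> y \<in> ?D" using \<tau>[OF y] S(2) by (auto simp: P_def E_def)
    show "y \<in> V (\<tau> y)" using F(2)[OF D] \<tau>[OF y] y by (auto simp: P_def D_set_def)
    define G where "G = (\<Union>x\<in>S (restrict y A). F x \<union> the ` x ` I)"
    define W where "W = {z \<in> topspace ?X. near I G y z}"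
    have G: "finite G"
    proof -
      have "finite (F x)" if "x \<in> S (restrict y A)" for x
        using S(2)[of "restrict y A"] that by (intro F(1)) (auto simp: E_def)
      then show ?thesis unfolding G_def using S(1) assms(1) by simp
    qed
    have "\<tau> z = \<tau> y" if z: "z \<in> W" for z
    proof -
      have nz: "near I G y z" using z by (simp add: W_def)
      have "z i = y i" if "i \<in> A" for i
        using near_Some[OF nz, of i] that y assms(2) by (auto simp: D_set_def)
      then have r: "restrict z A = restrict y A" by (intro restrict_ext)
      have "near I (F x) x z \<longleftrightarrow> near I (F x) x y" if "x \<in> S (restrict y A)" for x
        using that by (intro near_iff_of_near[OF nz]) (auto simp: G_def)
      then have "P z = P y" by (intro ext) (auto simp: P_def r)
      then show ?thesis by (simp add: \<tau>_def)
    qed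
    moreover have "openin (X_punctured K I) W"
      unfolding openin_X_punctured_iff[OF assms(1)]
    proof
      show "openin ?X W" unfolding W_def by (rule openin_near[OF assms(1) G])
      obtain i where "i \<in> A" using assms(3) by blast
      then have "i \<in> I" "y i \<noteq> None" using y assms(2) by (auto simp: D_set_def)
      then have "\<not> near I G y (X_infinity I)" using near_Some[of I G y "X_infinity I" i] by (auto simp: X_infinity_def)
      then show "X_infinity I \<notin> W" by (simp add: W_def)
    qed
    moreover have "y \<in> W" using y by (simp add: W_def D_set_def)
    ultimately show "\<exists>W. openin (X_punctured K I) W \<and> y \<in> W \<and> (\<forall>z\<in>W. \<tau> z = \<tau> y)" by blast
  qed
qed

lemma D_set_subset_topspace: "D_set K I A \<subseteq> topspace (X_space K I)"
  by (auto simp: D_set_def)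

lemma loc_const_const: "loc_const I U (\<lambda>x. a)"
  unfolding loc_const_def by (intro ballI exI[of _ "{}"]) simp

lemma loc_constI:
  assumes "\<And>x. x \<in> U \<Longrightarrow> \<exists>F. finite F \<and> (\<forall>y\<in>U. near I F x y \<longrightarrow> h y = h x)"
  shows "loc_const I U h"
  unfolding loc_const_def using assms by (rule ballI)

lemma loc_const_cong:
  assumes "loc_const I U g" "\<And>x. x \<in> U \<Longrightarrow> h x = g x"
  shows "loc_const I U h"
proof (rule loc_constI)
  fix x assume x: "x \<in> U"
  obtain F where F: "finite F" "\<forall>y\<in>U. near I F x y \<longrightarrow> g y = g x"
    using assms(1) x by (rule loc_constD)
  have "h y = h x" if "y \<in> U" "near I F x y" for y
    using bspec[OF F(2) that(1)] that(2) assms(2)[OF that(1)] assms(2)[OF x] by (simp only:)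
  then show "\<exists>F. finite F \<and> (\<forall>y\<in>U. near I F x y \<longrightarrow> h y = h x)"
    using F(1) by (intro exI[of _ F] conjI ballI impI)
qed

text \<open>The Cech theorem for the cover by the sets \<open>D_set K I {i}\<close>, with topology
  expressed through \<open>near\<close>.\<close>

lemma X_punctured_cech_coboundary:
  fixes c :: "nat set \<Rightarrow> (nat \<Rightarrow> 'k option) \<Rightarrow> bit"
  assumes "finite I"
    and triv: "carrier (sheaf_cohomology_Z2 (X_punctured K I) k) = {\<one>\<^bsub>sheaf_cohomology_Z2 (X_punctured K I) k\<^esub>}"
    and "k > 0"
    and lc: "\<And>A. A \<subseteq> I \<Longrightarrow> card A = Suc k \<Longrightarrow> loc_const I (D_set K I A) (c A)"
    and coc: "\<And>A x. A \<subseteq> I \<Longrightarrow> card A = Suc (Suc k) \<Longrightarrow> x \<in> D_set K I A \<Longrightarrow> (\<Sum>r\<in>A. c (A - {r}) x) = 0"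
  shows "\<exists>g. (\<forall>A\<subseteq>I. card A = k \<longrightarrow> loc_const I (D_set K I A) (g A)) \<and>
    (\<forall>A\<subseteq>I. card A = Suc k \<longrightarrow> (\<forall>x\<in>D_set K I A. c A x = (\<Sum>r\<in>A. g (A - {r}) x)))"
proof -
  let ?Y = "X_punctured K I" and ?U = "\<lambda>i. D_set K I {i}"
  define \<iota> where "\<iota> x = (SOME i. i \<in> I \<and> x i \<noteq> None)" for x :: "nat \<Rightarrow> 'k option"
  have \<iota>: "\<iota> x \<in> I \<and> x \<in> ?U (\<iota> x)" if x: "x \<in> topspace ?Y" for x
  proof -
    have "\<exists>i. i \<in> I \<and> x i \<noteq> None"
    proof (rule ccontr)
      assume "\<not> ?thesis"
      then have "x = X_infinity I"
        using x by (auto simp: topspace_X_punctured topspace_X_space X_infinity_def PiE_iff extensional_def)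
      with x show False by (simp add: topspace_X_punctured)
    qed
    then have "\<iota> x \<in> I \<and> x (\<iota> x) \<noteq> None" unfolding \<iota>_def by (rule someI_ex)
    then show ?thesis using x by (simp add: D_set_def topspace_X_punctured)
  qed
  \<comment> \<open>For \<open>A = {}\<close> this fails: \<open>D_set K I {}\<close> still contains
    the removed point.\<close>
  have cap: "cover_inter ?Y ?U A = D_set K I A" if "A \<subseteq> I" "A \<noteq> {}" for A
    using that by (fastforce simp: cover_inter_def D_set_def topspace_X_punctured X_infinity_def)
  have nonempty: "A \<noteq> {}" if "card A = Suc m" for A :: "nat set" and m using that by auto
  have "cech_cocycle ?Y I ?U k c \<iota>"
  proof
    fix A x assume A: "A \<subseteq> I" "card A = Suc k" and x: "x \<in> cover_inter ?Y ?U A"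
    note cap = cap[OF A(1) nonempty[OF A(2)]]
    have x: "x \<in> D_set K I A" using x by (simp only: cap)
    obtain F where F: "finite F" "\<forall>y\<in>D_set K I A. near I F x y \<longrightarrow> c A y = c A x"
      using lc[OF A] x by (rule loc_constD)
    let ?W = "{y \<in> topspace (X_space K I). near I F x y} \<inter> D_set K I A"
    have "openin ?Y ?W"
      using openin_near[OF assms(1) F(1), of K x] openin_D_set[OF assms(1) A(1) nonempty[OF A(2)], of K]
      by (simp add: openin_X_punctured_iff[OF assms(1)] openin_Int)
    moreover have "x \<in> ?W" using x by (auto simp: D_set_def)
    moreover have "\<forall>y\<in>?W \<inter> cover_inter ?Y ?U A. c A y = c A x" using F(2) by blast
    ultimately show "\<exists>W. openin ?Y W \<and> x \<in> W \<and> (\<forall>y\<in>W \<inter> cover_inter ?Y ?U A. c A y = c A x)"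
      by (intro exI[of _ ?W] conjI)
  next
    fix A x assume A: "A \<subseteq> I" "card A = Suc (Suc k)" and x: "x \<in> cover_inter ?Y ?U A"
    then show "(\<Sum>r\<in>A. c (A - {r}) x) = 0"
      using cap[OF A(1) nonempty[OF A(2)]] by (intro coc) auto
  next
    show "openin ?Y (?U i)" if "i \<in> I" for i
      using that assms(1) by (intro openin_D_set) auto
  qed (use assms(1) \<iota> in auto)
  from cech_cocycle.cech_coboundary[OF this triv \<open>k > 0\<close>]
  obtain g where g: "\<And>A x. A \<subseteq> I \<Longrightarrow> card A = k \<Longrightarrow> x \<in> cover_inter ?Y ?U A \<Longrightarrow>
      \<exists>W. openin ?Y W \<and> x \<in> W \<and> (\<forall>y\<in>W. g A y = g A x)"
    and cg: "\<And>A x. A \<subseteq> I \<Longrightarrow> card A = Suc k \<Longrightarrow> x \<in> cover_inter ?Y ?U A \<Longrightarrow> c A x = (\<Sum>r\<in>A. g (A - {r}) x)"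
    using cap ultraparacompact_D_set[OF assms(1)] by (smt (verit))
  show ?thesis
  proof (intro exI[of _ g] conjI allI impI ballI)
    fix A assume A: "A \<subseteq> I" "card A = k"
    have ne: "A \<noteq> {}" using A \<open>k > 0\<close> by auto
    show "loc_const I (D_set K I A) (g A)"
    proof (rule loc_constI)
      fix x assume x: "x \<in> D_set K I A"
      then obtain W where W: "openin ?Y W" "x \<in> W" "\<forall>y\<in>W. g A y = g A x"
        using g[OF A, of x] cap[OF A(1) ne] by blast
      from W(1) have "openin (X_space K I) W" by (simp add: openin_X_punctured_iff[OF assms(1)])
      with W(2) obtain F where F: "finite F" "\<forall>y\<in>topspace (X_space K I). near I F x y \<longrightarrow> y \<in> W"
        unfolding openin_X_space_iff[OF assms(1)] by blast
      have "g A y = g A x" if "y \<in> D_set K I A" "near I F x y" for y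
        using F(2) W(3) that D_set_subset_topspace by blast
      then show "\<exists>F. finite F \<and> (\<forall>y\<in>D_set K I A. near I F x y \<longrightarrow> g A y = g A x)"
        using F(1) by (intro exI[of _ F] conjI ballI impI)
    qed
  next
    fix A x assume A: "A \<subseteq> I" "card A = Suc k" and x: "x \<in> D_set K I A"
    then show "c A x = (\<Sum>r\<in>A. g (A - {r}) x)" using cap[OF A(1) nonempty[OF A(2)]] by (intro cg) auto
  qed
qed

section \<open>Cochains supported on a diagonal\<close>

text \<open>The identity \<open>\<iota> p a = a\<close> lets the coordinate \<open>p\<close> itself
  parametrize the diagonal.\<close>

locale diagonal =
  fixes K :: "nat \<Rightarrow> 'k set" and n p :: nat and B :: "nat set" and \<iota> :: "nat \<Rightarrow> 'k \<Rightarrow> 'k"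
  assumes p_le: "p \<le> n" and B_subset: "B \<subseteq> {p..n}"
    and finite_K: "\<And>j. j < p \<Longrightarrow> finite (K j)"
    and inj: "\<And>j. p \<le> j \<Longrightarrow> j \<le> n \<Longrightarrow> inj_on (\<iota> j) (K p)"
    and maps: "\<And>j a. p \<le> j \<Longrightarrow> j \<le> n \<Longrightarrow> a \<in> K p \<Longrightarrow> \<iota> j a \<in> K j"
    and \<iota>_p: "\<And>a. a \<in> K p \<Longrightarrow> \<iota> p a = a"
begin

abbreviation "I \<equiv> {0..n}"

definition "R = insert p ({p..n} - B)"

text \<open>The coordinates in \<open>B - {p}\<close> remain free; those below \<open>p\<close> sit
  at \<infinity>, which is isolated there because these factors are finite.\<close>

definition diag :: "(nat \<Rightarrow> 'k option) \<Rightarrow> bool" where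
  "diag x \<longleftrightarrow> (\<exists>a\<in>K p. \<forall>j\<in>R. x j = Some (\<iota> j a)) \<and> (\<forall>j<p. x j = None)"

lemma p_in_R: "p \<in> R"
  by (simp add: R_def)

lemma R_bounds: "j \<in> R \<Longrightarrow> p \<le> j \<and> j \<le> n"
  using p_le by (auto simp: R_def)

lemma finite_B: "finite B"
  using B_subset by (rule finite_subset) simp

lemma finite_R: "finite R"
  by (simp add: R_def)

lemma index_cases: "i \<in> I \<Longrightarrow> i < p \<or> i \<in> R \<or> i \<in> B - {p}"
  by (auto simp: R_def)

lemma diagE:
  assumes "diag x"
  obtains a where "a \<in> K p" "x p = Some a" "\<forall>j\<in>R. x j = Some (\<iota> j a)" "\<forall>j<p. x j = None"
  using assms p_in_R \<iota>_p unfolding diag_def by metis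

text \<open>A point off the diagonal with one diagonal coordinate finite has a whole neighbourhood off the
  diagonal, because this coordinate determines the others.\<close>

lemma diag_clopen:
  assumes x: "x \<in> topspace (X_space K I)" and j: "j \<in> R" "x j \<noteq> None"
  shows "\<exists>F. finite F \<and> (\<forall>y\<in>topspace (X_space K I). near I F x y \<longrightarrow> diag y = diag x)"
proof -
  \<comment> \<open>The first part keeps the infinite coordinates below \<open>p\<close> infinite.
    The second contains the coordinates of the only diagonal value compatible with
    \<open>x j\<close>, so that no neighbour of a point off the diagonal reaches it.\<close>
  define F where "F = (\<Union>i<p. K i) \<union> (\<Union>i\<in>R. \<iota> i ` {a \<in> K p. \<iota> j a = the (x j)})"
  have "finite {a \<in> K p. \<iota> j a = the (x j)}"
    by (rule finite_imageD[of "\<iota> j"])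
       (use inj[of j] R_bounds[OF j(1)] in \<open>auto intro: finite_subset[of _ "{the (x j)}"] inj_on_subset\<close>)
  then have "finite F" using finite_K finite_R by (simp add: F_def)
  moreover have "diag y = diag x" if y: "y \<in> topspace (X_space K I)" and near: "near I F x y" for y
  proof
    assume "diag x"
    then obtain a where a: "a \<in> K p" "\<forall>j\<in>R. x j = Some (\<iota> j a)" "\<forall>j<p. x j = None"
      by (rule diagE)
    have "y i = Some (\<iota> i a)" if "i \<in> R" for i
      using near_Some[OF near, of i] a(2) that R_bounds[OF that] by auto
    moreover have "y i = None" if i: "i < p" for i
    proof -
      have "i \<in> I" using i p_le by simp
      then have "y i \<in> insert None (Some ` K i)" using y by (auto simp: topspace_X_space PiE_iff)
      moreover have "y i \<noteq> Some b" if "b \<in> K i" for b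
        using near_None[OF near \<open>i \<in> I\<close>, of b] a(3) i that by (auto simp: F_def)
      ultimately show ?thesis by auto
    qed
    ultimately show "diag y" using a(1) by (auto simp: diag_def)
  next
    assume "diag y"
    then obtain a where a: "a \<in> K p" "\<forall>j\<in>R. y j = Some (\<iota> j a)" "\<forall>j<p. y j = None"
      by (rule diagE)
    have "y j = x j" using near_Some[OF near, of j] j R_bounds[of j] by simp
    then have "\<iota> j a = the (x j)" using a(2) j by (metis option.sel)
    then have F: "\<iota> i a \<in> F" if "i \<in> R" for i
      using a(1) that by (auto simp: F_def)
    have "x i = Some (\<iota> i a)" if i: "i \<in> R" for i
    proof -
      have "i \<in> I" using R_bounds[OF i] by simp
      then show ?thesis
        using near_Some[OF near \<open>i \<in> I\<close>] near_None[OF near \<open>i \<in> I\<close> _ F[OF i]] a(2) i by metis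
    qed
    moreover have "x i = None" if i: "i < p" for i
      using near_Some[OF near, of i] a(3) i p_le by fastforce
    ultimately show "diag x" using a(1) by (auto simp: diag_def)
  qed
  ultimately show ?thesis by blast
qed

text \<open>The coordinate \<open>j\<close> is finite on this set, so its diagonal part is clopen
  and extension by zero is continuous.\<close>

lemma loc_const_diag:
  assumes j: "j \<in> R" "j \<in> A" and lc: "loc_const I {x \<in> D_set K I A. diag x} h"
  shows "loc_const I (D_set K I A) (\<lambda>x. if diag x then h x else (0 :: bit))"
proof (rule loc_constI)
  fix x assume x: "x \<in> D_set K I A"
  then have "x \<in> topspace (X_space K I)" "x j \<noteq> None" using j by (auto simp: D_set_def)
  from diag_clopen[OF this(1) j(1) this(2)] obtain F where F: "finite F"
    "\<forall>y\<in>topspace (X_space K I). near I F x y \<longrightarrow> diag y = diag x" by blast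
  have F: "finite F" "\<And>y. y \<in> D_set K I A \<Longrightarrow> near I F x y \<Longrightarrow> diag y = diag x"
    using F D_set_subset_topspace by blast+
  show "\<exists>F. finite F \<and> (\<forall>y\<in>D_set K I A. near I F x y \<longrightarrow>
      (if diag y then h y else 0) = (if diag x then h x else 0))"
  proof (cases "diag x")
    case True
    then have "x \<in> {x \<in> D_set K I A. diag x}" using x by simp
    with lc obtain G where G: "finite G" "\<forall>y\<in>{x \<in> D_set K I A. diag x}. near I G x y \<longrightarrow> h y = h x"
      by (rule loc_constD)
    have "diag y \<and> h y = h x" if y: "y \<in> D_set K I A" "near I (F \<union> G) x y" for y
    proof -
      have "near I F x y" "near I G x y" using near_mono[OF y(2)] by auto
      then show ?thesis using F(2)[OF y(1)] G(2) True y(1) by blast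
    qed
    then show ?thesis using F(1) G(1) True by (intro exI[of _ "F \<union> G"]) auto
  next
    case False
    then show ?thesis using F by (intro exI[of _ F]) auto
  qed
qed

text \<open>The parametrization of the diagonal, completed by the limit \<open>a = None\<close>. If
  \<open>p \<in> B\<close>, the value \<open>a\<close> replaces \<open>y p\<close>.\<close>

definition diag_point :: "(nat \<Rightarrow> 'k option) \<Rightarrow> 'k option \<Rightarrow> nat \<Rightarrow> 'k option" where
  "diag_point y a = (\<lambda>i\<in>I. if i \<in> R then map_option (\<iota> i) a else if i \<in> B then y i else None)"

lemma diag_point_in_topspace:
  assumes "y \<in> topspace (X_space K B)" "a \<in> insert None (Some ` K p)"
  shows "diag_point y a \<in> topspace (X_space K I)"
  using assms maps R_bounds by (auto simp: diag_point_def topspace_X_space PiE_iff)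

lemma diag_point_B: "i \<in> B - {p} \<Longrightarrow> diag_point y a i = y i"
  using B_subset by (auto simp: diag_point_def R_def)

lemma diag_point_R: "i \<in> R \<Longrightarrow> diag_point y a i = map_option (\<iota> i) a"
  using R_bounds by (simp add: diag_point_def)

lemma diag_point_p: "a \<in> insert None (Some ` K p) \<Longrightarrow> diag_point y a p = a"
  using diag_point_R[OF p_in_R] \<iota>_p by auto

lemma diag_diag_point_Some: "a \<in> K p \<Longrightarrow> diag (diag_point y (Some a))"
  using diag_point_R B_subset p_le R_bounds by (fastforce simp: diag_def diag_point_def)

lemma not_diag_diag_point_None: "\<not> diag (diag_point y None)"
  using diag_point_R[OF p_in_R, of y None] p_in_R by (force simp: diag_def)

text \<open>Joint continuity of \<open>diag_point\<close>. Pulling \<open>F\<close> back along the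
  injections \<open>\<iota> i\<close> leaves finite sets.\<close>

lemma near_diag_point:
  assumes "finite F"
  shows "\<exists>G. finite G \<and> (\<forall>y y' a a'. near B G y y' \<longrightarrow> a' \<in> insert None (Some ` K p) \<longrightarrow>
    (if a = None then a' \<notin> Some ` G else a' = a) \<longrightarrow> near I F (diag_point y a) (diag_point y' a'))"
proof (intro exI conjI allI impI)
  let ?G = "F \<union> (\<Union>i\<in>R. {b \<in> K p. \<iota> i b \<in> F})"
  have "finite {b \<in> K p. \<iota> i b \<in> F}" if "i \<in> R" for i
    by (rule finite_imageD[of "\<iota> i"])
       (use inj[of i] R_bounds[OF that] assms in \<open>auto intro: finite_subset[of _ F] inj_on_subset\<close>)
  then show "finite ?G" using assms finite_R by simp
  fix y y' a a'
  assume near: "near B ?G y y'" and a': "a' \<in> insert None (Some ` K p)"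
    and a: "if a = None then a' \<notin> Some ` ?G else a' = a"
  show "near I F (diag_point y a) (diag_point y' a')"
    unfolding near_def
  proof
    fix i assume i: "i \<in> I"
    consider "i \<in> R" | "i \<in> B - {p}" | "i \<notin> R" "i \<notin> B" using p_in_R by blast
    then show "if diag_point y a i = None then diag_point y' a' i \<notin> Some ` F else diag_point y' a' i = diag_point y a i"
    proof cases
      case 1
      then show ?thesis using a a' by (cases a; cases a') (auto simp: diag_point_R)
    next
      case 2
      then have "i \<in> B" by simp
      then show ?thesis
        using near 2 unfolding near_def diag_point_B[OF 2] by auto
    next
      case 3
      then show ?thesis using i by (auto simp: diag_point_def)
    qed
  qed
qed

end

lemma loc_const_subset: "loc_const I U h \<Longrightarrow> V \<subseteq> U \<Longrightarrow> loc_const I V h"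
  unfolding loc_const_def by (meson subsetD)

text \<open>Here \<open>u\<close> is the component at \<open>B\<close>, and \<open>v A\<close> the
  component at \<open>A\<close> together with one index of \<open>R\<close>. The equation
  \<open>u_eq\<close> is the cocycle condition on \<open>B \<union> {p}\<close>.\<close>

locale diagonal_cochain = diagonal K n p B \<iota>
  for K :: "nat \<Rightarrow> 'k set" and n p :: nat and B :: "nat set" and \<iota> :: "nat \<Rightarrow> 'k \<Rightarrow> 'k" +
  fixes k :: nat and u :: "(nat \<Rightarrow> 'k option) \<Rightarrow> bit" and v :: "nat set \<Rightarrow> (nat \<Rightarrow> 'k option) \<Rightarrow> bit"
  assumes card_B: "card B = Suc k"
    and v_loc_const: "\<And>A. A \<subseteq> B - {p} \<Longrightarrow> card A = k \<Longrightarrow> loc_const {0..n} {x \<in> D_set K {0..n} A. diag x} (v A)"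
    and u_loc_const: "p \<notin> B \<Longrightarrow> loc_const {0..n} (D_set K {0..n} B) (\<lambda>x. if diag x then u x else 0)"
    and u_eq: "\<And>x. p \<notin> B \<Longrightarrow> x \<in> D_set K {0..n} B \<Longrightarrow> diag x \<Longrightarrow> u x = (\<Sum>i\<in>B. v (B - {i}) x)"
begin

text \<open>All indices in \<open>R\<close> play the role of \<open>p\<close>: a cocycle on the coordinates \<open>B \<union> {p}\<close> that
  vanishes where the coordinate \<open>p\<close> is \<open>\<infinity>\<close> is copied along the diagonal.\<close>

definition c :: "nat set \<Rightarrow> (nat \<Rightarrow> 'k option) \<Rightarrow> bit" where
  "c A x = (if diag x then if A \<inter> R = {} then u x else if card (A \<inter> R) = 1 then v (A - R) x else 0 else 0)"

text \<open>On the diagonal all coordinates below \<open>p\<close> are infinite, so such indices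
  cannot lie in \<open>A\<close>.\<close>

lemma diag_index_subset:
  assumes "A \<subseteq> I" "x \<in> D_set K I A" "diag x"
  shows "A - R \<subseteq> B - {p}"
proof
  fix i assume i: "i \<in> A - R"
  then have "x i \<noteq> None" using assms(2) by (simp add: D_set_def)
  then have "\<not> i < p" using assms(3) by (auto simp: diag_def)
  then show "i \<in> B - {p}" using i index_cases[of i] assms(1) by auto
qed

text \<open>By the number of indices of \<open>A\<close> in \<open>R\<close>: none is impossible by
  cardinality; one gives \<open>u_eq\<close>; two give two equal terms, which cancel; with more,
  every face still has at least two.\<close>

lemma c_cocycle:
  assumes A: "A \<subseteq> I" "card A = Suc (Suc k)" and x: "x \<in> D_set K I A"
  shows "(\<Sum>r\<in>A. c (A - {r}) x) = 0"
proof (cases "diag x")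
  case False
  then show ?thesis by (simp add: c_def)
next
  case True
  let ?P = "A \<inter> R" and ?Q = "A - R"
  have Q: "?Q \<subseteq> B - {p}" by (rule diag_index_subset[OF A(1) x True])
  have fin: "finite A" using A(1) finite_subset by blast
  then have card: "card ?P + card ?Q = Suc (Suc k)"
    using A(2) card_Int_Diff[OF fin, of R] by simp
  have "card ?Q \<le> card (B - {p})" using Q finite_B by (intro card_mono) auto
  then have Q_le: "card ?Q \<le> Suc k" and Q_le': "p \<in> B \<Longrightarrow> card ?Q \<le> k"
    using card_B finite_B by (auto simp: card_Diff_singleton_if split: if_splits)
  have split: "(\<Sum>r\<in>A. c (A - {r}) x) = (\<Sum>r\<in>?P. c (A - {r}) x) + (\<Sum>r\<in>?Q. c (A - {r}) x)"
    by (rule sum.Int_Diff[OF fin])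
  have P_P: "(A - {r}) \<inter> R = ?P - {r}" "A - {r} - R = ?Q" if "r \<in> ?P" for r using that by auto
  have P_Q: "(A - {r}) \<inter> R = ?P" "A - {r} - R = ?Q - {r}" if "r \<in> ?Q" for r using that by auto
  consider "card ?P = 1" | "card ?P = 2" | "card ?P > 2" using card Q_le by linarith
  then show ?thesis
  proof cases
    case 1
    then obtain j where j: "?P = {j}" by (auto simp: card_1_singleton_iff)
    have "card ?Q = card B" using card 1 card_B by simp
    then have QB: "?Q = B" using Q by (intro card_subset_eq[OF finite_B]) auto
    with Q have p: "p \<notin> B" by blast
    have xB: "x \<in> D_set K I B" using x QB by (auto simp: D_set_def)
    have "j \<in> ?P" using j by simp
    from P_P[OF this] have "c (A - {j}) x = u x" using j True by (simp add: c_def)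
    then have sum_P: "(\<Sum>r\<in>?P. c (A - {r}) x) = u x" unfolding j by simp
    have "c (A - {r}) x = v (B - {r}) x" if "r \<in> B" for r
      using that P_Q[of r] unfolding QB j c_def by (simp add: True)
    then have "(\<Sum>r\<in>?Q. c (A - {r}) x) = (\<Sum>i\<in>B. v (B - {i}) x)"
      unfolding QB by (rule sum.cong[OF refl])
    then show ?thesis unfolding split sum_P u_eq[OF p xB True] by simp
  next
    case 2
    then have "?P \<noteq> {}" by force
    then have "c (A - {r}) x = 0" if "r \<in> ?Q" for r
      using 2 unfolding c_def P_Q[OF that] by simp
    then have "(\<Sum>r\<in>?Q. c (A - {r}) x) = 0" by (rule sum.neutral[OF ballI])
    moreover have "c (A - {r}) x = v ?Q x" if "r \<in> ?P" for r
    proof -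
      have "card (?P - {r}) = 1" using 2 that fin by (simp add: card_Diff_singleton)
      moreover from this have "?P - {r} \<noteq> {}" by force
      ultimately show ?thesis unfolding c_def P_P[OF that] using True by simp
    qed
    then have "(\<Sum>r\<in>?P. c (A - {r}) x) = 0" using 2 by simp
    ultimately show ?thesis using split by simp
  next
    case 3
    have "c (A - {r}) x = 0" if "r \<in> A" for r
    proof -
      have "(A - {r}) \<inter> R = ?P - {r}" by blast
      then have "card ?P - 1 \<le> card ((A - {r}) \<inter> R)"
        using diff_card_le_card_Diff[of "{r}" ?P] by simp
      then have "card ((A - {r}) \<inter> R) > 1" using 3 by linarith
      moreover from this have "(A - {r}) \<inter> R \<noteq> {}" by force
      ultimately show ?thesis by (simp add: c_def)
    qed
    then show ?thesis by simp
  qed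
qed

text \<open>A single index of \<open>A\<close> in \<open>R\<close> makes the diagonal clopen. If
  there is none, then \<open>A = B\<close>, where continuity is an assumption of the locale.\<close>

lemma c_loc_const:
  assumes A: "A \<subseteq> I" "card A = Suc k"
  shows "loc_const I (D_set K I A) (c A)"
proof (cases "A - R \<subseteq> B - {p}")
  case False
  then show ?thesis
    using diag_index_subset[OF A(1)] by (intro loc_const_cong[OF loc_const_const[of _ _ 0]]) (auto simp: c_def)
next
  case Q: True
  have fin: "finite A" using A(1) finite_subset by blast
  consider "A \<inter> R = {}" | j where "A \<inter> R = {j}" | "A \<inter> R \<noteq> {}" "card (A \<inter> R) \<noteq> 1"
    using card_1_singleton_iff by (metis One_nat_def)
  then show ?thesis
  proof cases
    case 1
    then have "A \<subseteq> B - {p}" using Q by auto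
    then have "A = B" using A(2) card_B by (intro card_subset_eq[OF finite_B]) auto
    moreover from this have "p \<notin> B" using \<open>A \<subseteq> B - {p}\<close> by blast
    moreover have "c A = (\<lambda>x. if diag x then u x else 0)" using 1 by (simp add: fun_eq_iff c_def)
    ultimately show ?thesis using u_loc_const by simp
  next
    case 2
    have "card A = card (A \<inter> R) + card (A - R)"
      using fin by (rule card_Int_Diff)
    then have "card (A - R) = k" using A(2) 2 by simp
    then have "loc_const I {x \<in> D_set K I A. diag x} (v (A - R))"
      by (intro loc_const_subset[OF v_loc_const[OF Q]]) (auto simp: D_set_def)
    then have "loc_const I (D_set K I A) (\<lambda>x. if diag x then v (A - R) x else 0)"
      using 2 by (intro loc_const_diag[of j]) auto
    moreover have "c A = (\<lambda>x. if diag x then v (A - R) x else 0)" using 2 by (simp add: fun_eq_iff c_def)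
    ultimately show ?thesis by simp
  next
    case 3
    then have "c A = (\<lambda>x. 0)" by (simp add: fun_eq_iff c_def)
    then show ?thesis by (simp add: loc_const_const)
  qed
qed

lemma c_coboundary:
  assumes "carrier (sheaf_cohomology_Z2 (X_punctured K I) k) = {\<one>\<^bsub>sheaf_cohomology_Z2 (X_punctured K I) k\<^esub>}"
    and "k > 0"
  shows "\<exists>g. (\<forall>i\<in>B. loc_const I (D_set K I (B - {i})) (g i)) \<and>
    (\<forall>x\<in>D_set K I B. c B x = (\<Sum>i\<in>B. g i x))"
proof -
  have B: "B \<subseteq> I" using B_subset by auto
  obtain g where g: "\<forall>A\<subseteq>I. card A = k \<longrightarrow> loc_const I (D_set K I A) (g A)"
    "\<forall>A\<subseteq>I. card A = Suc k \<longrightarrow> (\<forall>x\<in>D_set K I A. c A x = (\<Sum>r\<in>A. g (A - {r}) x))"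
    using X_punctured_cech_coboundary[OF finite_atLeastAtMost assms c_loc_const c_cocycle] by blast
  show ?thesis
  proof (intro exI[of _ "\<lambda>i. g (B - {i})"] conjI ballI)
    show "loc_const I (D_set K I (B - {i})) (g (B - {i}))" if "i \<in> B" for i
    proof -
      have "card (B - {i}) = k" using that card_B finite_B by simp
      then show ?thesis using g(1) B by blast
    qed
    show "c B x = (\<Sum>i\<in>B. g (B - {i}) x)" if "x \<in> D_set K I B" for x
      using g(2) B card_B that by blast
  qed
qed

end

section \<open>Pulling primitives back to the coordinates in \<open>B\<close>\<close>

context diagonal
begin

lemma diag_point_in_D_set:
  assumes "y \<in> D_set K B A" "A \<subseteq> B" "a \<in> insert None (Some ` K p)" "p \<in> A \<longrightarrow> a \<noteq> None"
  shows "diag_point y a \<in> D_set K I A"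
proof -
  have "diag_point y a i \<noteq> None" if "i \<in> A" for i
  proof (cases "i = p")
    case True
    then show ?thesis using assms(3,4) that diag_point_p by metis
  next
    case False
    then have "diag_point y a i = y i" using assms(2) that by (intro diag_point_B) auto
    then show ?thesis using assms(1) that by (simp add: D_set_def)
  qed
  moreover have "diag_point y a \<in> topspace (X_space K I)"
    using assms(1,3) by (intro diag_point_in_topspace) (auto simp: D_set_def)
  ultimately show ?thesis by (simp add: D_set_def)
qed

lemma loc_const_diag_point:
  assumes h: "loc_const I (D_set K I A) h" and A: "A \<subseteq> B"
    and y: "y \<in> D_set K B A" and a: "a \<in> insert None (Some ` K p)" "p \<in> A \<longrightarrow> a \<noteq> None"
  shows "\<exists>G. finite G \<and> (\<forall>y'\<in>D_set K B A. \<forall>a'\<in>insert None (Some ` K p). near B G y y' \<longrightarrow>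
    (if a = None then a' \<notin> Some ` G else a' = a) \<longrightarrow> h (diag_point y' a') = h (diag_point y a))"
proof -
  obtain F where F: "finite F" "\<forall>x\<in>D_set K I A. near I F (diag_point y a) x \<longrightarrow> h x = h (diag_point y a)"
    using h diag_point_in_D_set[OF y A a] by (rule loc_constD)
  obtain G where G: "finite G" "\<forall>y y' a a'. near B G y y' \<longrightarrow> a' \<in> insert None (Some ` K p) \<longrightarrow>
    (if a = None then a' \<notin> Some ` G else a' = a) \<longrightarrow> near I F (diag_point y a) (diag_point y' a')"
    using near_diag_point[OF F(1)] by (elim exE conjE)
  show ?thesis
  proof (intro exI[of _ G] conjI ballI impI)
    fix y' a' assume y': "y' \<in> D_set K B A" and a': "a' \<in> insert None (Some ` K p)"
      and near: "near B G y y'" and aa: "if a = None then a' \<notin> Some ` G else a' = a"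
    have "near I F (diag_point y a) (diag_point y' a')" using G(2) near a' aa by blast
    moreover have "p \<in> A \<longrightarrow> a' \<noteq> None" using a(2) aa by auto
    ultimately show "h (diag_point y' a') = h (diag_point y a)"
      using F(2) diag_point_in_D_set[OF y' A a'] by blast
  qed (rule G(1))
qed

text \<open>Spread along the diagonal, \<open>f\<close> is a cocycle; its primitive is pulled back
  along \<open>diag_point y (y p)\<close>.\<close>

lemma top_coboundary_if_mem:
  assumes triv: "carrier (sheaf_cohomology_Z2 (X_punctured K I) k) = {\<one>\<^bsub>sheaf_cohomology_Z2 (X_punctured K I) k\<^esub>}"
    and "k > 0" and card_B: "card B = Suc k" and p: "p \<in> B"
  shows "top_coboundary K B f"
proof -
  interpret diagonal_cochain K n p B \<iota> k "\<lambda>_. 0" "\<lambda>_ x. f (restrict x B)"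
  proof
    fix A assume A: "A \<subseteq> B - {p}" "card A = k"
    have "card (B - {p}) = k" using card_B p finite_B by simp
    \<comment> \<open>The diagonal also makes the coordinate \<open>p\<close> finite, so all
      coordinates in \<open>B\<close> are fixed nearby and any \<open>f\<close> is locally
      constant.\<close>
    then have A: "A = B - {p}" using A finite_B by (intro card_subset_eq) auto
    show "loc_const I {x \<in> D_set K I A. diag x} (\<lambda>x. f (restrict x B))"
    proof (rule loc_constI)
      fix x assume x: "x \<in> {x \<in> D_set K I A. diag x}"
      have ne: "x i \<noteq> None" if "i \<in> B" for i
      proof (cases "i = p")
        case True
        then show ?thesis using x by (auto elim: diagE)
      qed (use x A that in \<open>simp add: D_set_def\<close>)
      have "restrict y B = restrict x B" if "near I {} x y" for y
      proof (rule restrict_ext)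
        fix i assume "i \<in> B"
        then show "y i = x i" using near_Some[OF that _ ne[of i]] B_subset by auto
      qed
      then show "\<exists>F. finite F \<and> (\<forall>y\<in>{x \<in> D_set K I A. diag x}. near I F x y \<longrightarrow> f (restrict y B) = f (restrict x B))"
        by (intro exI[of _ "{}"] conjI ballI impI finite.emptyI arg_cong[where f = f])
    qed
  qed (use card_B p in auto)
  from c_coboundary[OF triv \<open>k > 0\<close>]
  obtain g where "(\<forall>i\<in>B. loc_const I (D_set K I (B - {i})) (g i)) \<and>
    (\<forall>x\<in>D_set K I B. c B x = (\<Sum>i\<in>B. g i x))" ..
  note g = conjunct1[OF this, rule_format] conjunct2[OF this, rule_format]
  have yp: "y p \<in> insert None (Some ` K p)" if "y \<in> D_set K B A" for y A
    using that p by (auto simp: D_set_def topspace_X_space PiE_iff)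
  show ?thesis
    unfolding top_coboundary_iff[OF finite_B]
  proof (intro exI[of _ "\<lambda>i y. g i (diag_point y (y p))"] conjI ballI)
    fix i assume i: "i \<in> B"
    show "loc_const B (D_set K B (B - {i})) (\<lambda>y. g i (diag_point y (y p)))"
    proof (rule loc_constI)
      fix y assume y: "y \<in> D_set K B (B - {i})"
      then have "p \<in> B - {i} \<longrightarrow> y p \<noteq> None" by (simp add: D_set_def)
      from loc_const_diag_point[OF g(1)[OF i] Diff_subset y yp[OF y] this]
      obtain G where G: "finite G" "\<forall>y'\<in>D_set K B (B - {i}). \<forall>a'\<in>insert None (Some ` K p). near B G y y' \<longrightarrow>
          (if y p = None then a' \<notin> Some ` G else a' = y p) \<longrightarrow> g i (diag_point y' a') = g i (diag_point y (y p))"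
        by (elim exE conjE)
      have "g i (diag_point y' (y' p)) = g i (diag_point y (y p))"
        if y': "y' \<in> D_set K B (B - {i})" and near: "near B G y y'" for y'
      proof -
        have "if y p = None then y' p \<notin> Some ` G else y' p = y p" using near p by (simp add: near_def)
        then show ?thesis by (rule G(2)[rule_format, OF y' yp[OF y'] near])
      qed
      then show "\<exists>F. finite F \<and> (\<forall>y'\<in>D_set K B (B - {i}). near B F y y' \<longrightarrow>
          g i (diag_point y' (y' p)) = g i (diag_point y (y p)))"
        using G(1) by (intro exI[of _ G] conjI ballI impI)
    qed
  next
    fix y assume y: "y \<in> D_set K B B"
    then have ne: "y p \<noteq> None" using p by (simp add: D_set_def)
    then obtain a where a: "y p = Some a" "a \<in> K p" using yp[OF y] by auto
    have "restrict (diag_point y (y p)) B = y"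
    proof
      fix i show "restrict (diag_point y (y p)) B i = y i"
        using y diag_point_B[of i y "y p"] diag_point_p[OF yp[OF y], of y]
        by (cases "i \<in> B"; cases "i = p") (auto simp: D_set_def topspace_X_space PiE_iff extensional_def)
    qed
    moreover have "B \<inter> R = {p}" using p p_in_R by (auto simp: R_def)
    ultimately have "c B (diag_point y (y p)) = f y"
      by (simp add: c_def a diag_diag_point_Some)
    moreover have "diag_point y (y p) \<in> D_set K I B"
      using diag_point_in_D_set[OF y order_refl yp[OF y]] ne by blast
    ultimately show "f y = (\<Sum>i\<in>B. g i (diag_point y (y p)))" using g(2) by metis
  qed
qed

text \<open>Only the differences of consecutive \<open>\<psi> a\<close> along a sequence in \<open>K p\<close> are used for the cocycle,
  which makes it vanish at \<open>\<infinity>\<close>. If it is a coboundary, the differences are locally finite sums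
  of the components of a coboundary, and telescoping shows that their total is one.\<close>

lemma top_coboundary_limit:
  assumes triv: "carrier (sheaf_cohomology_Z2 (X_punctured K I) k) = {\<one>\<^bsub>sheaf_cohomology_Z2 (X_punctured K I) k\<^esub>}"
    and "k > 0" and card_B: "card B = Suc k" and p: "p \<notin> B" and "infinite (K p)"
    and \<psi>: "\<And>y. y \<in> D_set K B B \<Longrightarrow> finite {a \<in> K p. \<psi> a y \<noteq> f y}"
    and \<psi>_cob: "\<And>a. a \<in> K p \<Longrightarrow> top_coboundary K B (\<psi> a)"
  shows "top_coboundary K B f"
proof -
  obtain s :: "nat \<Rightarrow> 'k" where s: "inj s" "range s \<subseteq> K p"
    using infinite_countable_subset[OF \<open>infinite (K p)\<close>] by blast
  \<comment> \<open>The shift along the sequence, extended by the identity so that the differences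
    \<open>d a\<close> vanish off the sequence.\<close>
  define \<theta> where "\<theta> a = (if a \<in> range s then s (Suc (inv_into UNIV s a)) else a)" for a
  have \<theta>_s: "\<theta> (s m) = s (Suc m)" for m using s(1) by (simp add: \<theta>_def)
  have \<theta>_K: "\<theta> a \<in> K p" if "a \<in> K p" for a using that s(2) by (auto simp: \<theta>_def)
  have \<theta>_inj: "inj \<theta>"
  proof (rule injI)
    fix a b assume eq: "\<theta> a = \<theta> b"
    show "a = b"
    proof (cases "a \<in> range s"; cases "b \<in> range s")
      assume "a \<in> range s" "b \<in> range s"
      then show ?thesis using eq s(1) by (auto simp: \<theta>_s inj_eq)
    qed (use eq in \<open>auto simp: \<theta>_def\<close>)
  qed
  define d where "d a y = \<psi> (\<theta> a) y + \<psi> a y" for a y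
  have d_fin: "finite {a \<in> K p. d a y \<noteq> 0}" if y: "y \<in> D_set K B B" for y
  proof (rule finite_subset)
    \<comment> \<open>A nonzero difference needs \<open>a\<close> or \<open>\<theta> a\<close> to be
      exceptional for \<open>\<psi>\<close>; injectivity of \<theta> keeps this finite.\<close>
    show "{a \<in> K p. d a y \<noteq> 0} \<subseteq> {a \<in> K p. \<psi> a y \<noteq> f y} \<union> \<theta> -` {a \<in> K p. \<psi> a y \<noteq> f y}"
      using \<theta>_K by (auto simp: d_def simp del: bit_not_zero_iff)
    show "finite ({a \<in> K p. \<psi> a y \<noteq> f y} \<union> \<theta> -` {a \<in> K p. \<psi> a y \<noteq> f y})"
      by (intro finite_UnI \<psi>[OF y] finite_vimageI[OF _ \<theta>_inj])
  qed
  have "\<forall>a\<in>K p. \<exists>h. (\<forall>i\<in>B. loc_const B (D_set K B (B - {i})) (h i)) \<and> (\<forall>y\<in>D_set K B B. d a y = (\<Sum>i\<in>B. h i y))"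
    using top_coboundary_add[OF finite_B \<psi>_cob[OF \<theta>_K] \<psi>_cob]
    unfolding top_coboundary_iff[OF finite_B] d_def by blast
  \<comment> \<open>The decompositions are chosen separately for each \<open>a\<close>; on the
    diagonal the coordinate \<open>p\<close> is finite, so no uniformity in \<open>a\<close> is
    required.\<close>
  from bchoice[OF this] obtain h where h:
    "\<forall>a\<in>K p. (\<forall>i\<in>B. loc_const B (D_set K B (B - {i})) (h a i)) \<and> (\<forall>y\<in>D_set K B B. d a y = (\<Sum>i\<in>B. h a i y))" ..
  have BI: "B \<subseteq> I" using B_subset by auto
  have near_B: "near B F (restrict x B) (restrict y B)" if "near I F x y" for F x y
    unfolding near_def
  proof
    fix i assume i: "i \<in> B"
    then have "i \<in> I" using BI by blast
    from bspec[OF that[unfolded near_def] this] i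
    show "if restrict x B i = None then restrict y B i \<notin> Some ` F else restrict y B i = restrict x B i" by simp
  qed
  have restrict_D: "restrict x B \<in> D_set K B A" if "x \<in> D_set K I A" "A \<subseteq> B" for x A
  proof -
    have "x i \<in> insert None (Some ` K i)" if "i \<in> B" for i
      using \<open>x \<in> D_set K I A\<close> subsetD[OF BI that] by (simp add: D_set_def topspace_X_space PiE_iff)
    moreover have "restrict x B i \<noteq> None" if "i \<in> A" for i
      using \<open>x \<in> D_set K I A\<close> subsetD[OF \<open>A \<subseteq> B\<close> that] that by (simp add: D_set_def)
    ultimately show ?thesis by (simp add: D_set_def topspace_X_space PiE_iff del: not_None_eq)
  qed
  \<comment> \<open>For \<open>A = B - {i}\<close> the term \<open>the_elem (B - A)\<close> recovers
    \<open>i\<close>.\<close>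
  interpret diagonal_cochain K n p B \<iota> k "\<lambda>x. d (the (x p)) (restrict x B)"
    "\<lambda>A x. h (the (x p)) (the_elem (B - A)) (restrict x B)"
  proof
    fix A assume A: "A \<subseteq> B - {p}" "card A = k"
    have "card (B - A) = 1" using A p card_B finite_B by (subst card_Diff_subset) (auto intro: finite_subset)
    then obtain i where i: "B - A = {i}" by (auto simp: card_1_singleton_iff)
    then have A: "A = B - {i}" "i \<in> B" using A by auto
    show "loc_const I {x \<in> D_set K I A. diag x} (\<lambda>x. h (the (x p)) (the_elem (B - A)) (restrict x B))"
    proof (rule loc_constI)
      fix x assume x: "x \<in> {x \<in> D_set K I A. diag x}"
      then obtain a where a: "a \<in> K p" "x p = Some a" by (auto elim: diagE)
      have "loc_const B (D_set K B (B - {i})) (h a i)" using h a(1) A(2) by blast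
      moreover have xB: "restrict x B \<in> D_set K B (B - {i})" using x A by (intro restrict_D) auto
      ultimately obtain F where F: "finite F"
        "\<forall>y\<in>D_set K B (B - {i}). near B F (restrict x B) y \<longrightarrow> h a i y = h a i (restrict x B)"
        by (rule loc_constD)
      have "h (the (y p)) (the_elem (B - A)) (restrict y B) = h (the (x p)) (the_elem (B - A)) (restrict x B)"
        if y: "y \<in> {x \<in> D_set K I A. diag x}" and near: "near I F x y" for y
      proof -
        have "y p = x p" using near_Some[OF near, of p] a(2) p_le by simp
        moreover have "restrict y B \<in> D_set K B (B - {i})" using y A by (intro restrict_D) auto
        then have "h a i (restrict y B) = h a i (restrict x B)"
          using F(2) near_B[OF near] by blast
        ultimately show ?thesis using a(2) i by simp
      qed
      then show "\<exists>F. finite F \<and> (\<forall>y\<in>{x \<in> D_set K I A. diag x}. near I F x y \<longrightarrow>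
          h (the (y p)) (the_elem (B - A)) (restrict y B) = h (the (x p)) (the_elem (B - A)) (restrict x B))"
        using F(1) by (intro exI[of _ F] conjI ballI impI)
    qed
  next
    show "loc_const I (D_set K I B) (\<lambda>x. if diag x then d (the (x p)) (restrict x B) else 0)"
    proof (rule loc_constI)
      fix x assume x: "x \<in> D_set K I B"
      then have xt: "x \<in> topspace (X_space K I)" by (simp add: D_set_def)
      have xB: "x i \<noteq> None" if "i \<in> B" for i using x that by (simp add: D_set_def)
      have r: "restrict y B = restrict x B" if "near I F x y" for F y
        using near_Some[OF that] xB BI by (intro restrict_ext) auto
      show "\<exists>F. finite F \<and> (\<forall>y\<in>D_set K I B. near I F x y \<longrightarrow>
          (if diag y then d (the (y p)) (restrict y B) else 0) = (if diag x then d (the (x p)) (restrict x B) else 0))"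
      proof (cases "x p = None")
        case True
        \<comment> \<open>Near such \<open>x\<close> the coordinates in \<open>B\<close> are fixed,
          and avoiding the finitely many nonzero differences forces the value 0.\<close>
        define F where "F = {a \<in> K p. d a (restrict x B) \<noteq> 0}"
        have "finite F" unfolding F_def by (rule d_fin[OF restrict_D[OF x order_refl]])
        moreover have "(if diag y then d (the (y p)) (restrict y B) else 0) = 0"
          if near: "near I F x y" for y
        proof (cases "diag y")
          case True
          then obtain a where a: "a \<in> K p" "y p = Some a" by (rule diagE)
          then have "a \<notin> F" using near_None[OF near _ \<open>x p = None\<close>, of a] p_le by auto
          then show ?thesis using a True r[OF near] by (simp add: F_def)
        qed simp
        moreover have "\<not> diag x" using True by (auto elim: diagE)
        ultimately show ?thesis by (intro exI[of _ F]) simp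
      next
        case False
        from diag_clopen[OF xt p_in_R False] obtain F where F: "finite F"
          "\<forall>y\<in>topspace (X_space K I). near I F x y \<longrightarrow> diag y = diag x" by blast
        have "(if diag y then d (the (y p)) (restrict y B) else 0) = (if diag x then d (the (x p)) (restrict x B) else 0)"
          if y: "y \<in> D_set K I B" and near: "near I F x y" for y
        proof -
          have "diag y = diag x" using F(2) near y D_set_subset_topspace by blast
          moreover have "y p = x p" using near_Some[OF near _ False] p_le by simp
          ultimately show ?thesis using r[OF near] by simp
        qed
        then show ?thesis using F(1) by (intro exI[of _ F] conjI ballI impI)
      qed
    qed
  next
    fix x assume x: "x \<in> D_set K I B" "diag x"
    from x(2) obtain a where a: "a \<in> K p" "x p = Some a" by (rule diagE)
    have "d a (restrict x B) = (\<Sum>i\<in>B. h a i (restrict x B))"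
      using h a(1) restrict_D[OF x(1) order_refl] by blast
    also have "\<dots> = (\<Sum>i\<in>B. h a (the_elem (B - (B - {i}))) (restrict x B))"
      by (intro sum.cong refl) (simp add: double_diff)
    finally show "d (the (x p)) (restrict x B) =
        (\<Sum>i\<in>B. h (the (x p)) (the_elem (B - (B - {i}))) (restrict x B))"
      using a(2) by simp
  qed (rule card_B)
  from c_coboundary[OF triv \<open>k > 0\<close>]
  obtain g where "(\<forall>i\<in>B. loc_const I (D_set K I (B - {i})) (g i)) \<and>
    (\<forall>x\<in>D_set K I B. c B x = (\<Sum>i\<in>B. g i x))" ..
  note g = conjunct1[OF this, rule_format] conjunct2[OF this, rule_format]
  have BR: "B \<inter> R = {}" using p by (auto simp: R_def)
  define H where "H i y a = g i (diag_point y a)" for i y a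
  have H_sum_Some: "(\<Sum>i\<in>B. H i y (Some a)) = d a y" if y: "y \<in> D_set K B B" and a: "a \<in> K p" for y a
  proof -
    have "restrict (diag_point y (Some a)) B = y"
    proof
      fix i show "restrict (diag_point y (Some a)) B i = y i"
        using y diag_point_B[of i y "Some a"] p
        by (cases "i \<in> B"; cases "i = p") (auto simp: D_set_def topspace_X_space PiE_iff extensional_def)
    qed
    then have "c B (diag_point y (Some a)) = d a y"
      using BR a diag_point_p[of "Some a" y] by (simp add: c_def diag_diag_point_Some)
    moreover have "diag_point y (Some a) \<in> D_set K I B"
      using y a by (intro diag_point_in_D_set) auto
    ultimately show ?thesis using g(2) by (simp add: H_def)
  qed
  have H_sum_None: "(\<Sum>i\<in>B. H i y None) = 0" if y: "y \<in> D_set K B B" for y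
  proof -
    have "c B (diag_point y None) = 0" using not_diag_diag_point_None by (simp add: c_def)
    moreover have "diag_point y None \<in> D_set K I B"
      using y p by (intro diag_point_in_D_set) auto
    ultimately show ?thesis using g(2) by (simp add: H_def)
  qed
  have H_loc: "\<exists>G. finite G \<and> (\<forall>y'\<in>D_set K B (B - {i}). \<forall>a'\<in>insert None (Some ` K p). near B G y y' \<longrightarrow>
      (if a = None then a' \<notin> Some ` G else a' = a) \<longrightarrow> H i y' a' = H i y a)"
    if "i \<in> B" "y \<in> D_set K B (B - {i})" "a \<in> insert None (Some ` K p)" for i y a
    unfolding H_def using that p by (intro loc_const_diag_point g(1)) auto
  have H_loc_None: "\<exists>G. finite G \<and> (\<forall>y'\<in>D_set K B (B - {i}). \<forall>a'\<in>insert None (Some ` K p). near B G y y' \<longrightarrow>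
      a' \<notin> Some ` G \<longrightarrow> H i y' a' = H i y None)"
    if "i \<in> B" "y \<in> D_set K B (B - {i})" for i y
    using H_loc[OF that insertI1] by (simp only: simp_thms if_True)
  have H_loc_Some: "\<exists>G. finite G \<and> (\<forall>y'\<in>D_set K B (B - {i}). near B G y y' \<longrightarrow> H i y' (Some a) = H i y (Some a))"
    if iy: "i \<in> B" "y \<in> D_set K B (B - {i})" and a: "a \<in> K p" for i y a
  proof -
    have a': "Some a \<in> insert None (Some ` K p)" using a by simp
    obtain G where G: "finite G" "\<forall>y'\<in>D_set K B (B - {i}). \<forall>a'\<in>insert None (Some ` K p). near B G y y' \<longrightarrow>
      (if Some a = None then a' \<notin> Some ` G else a' = Some a) \<longrightarrow> H i y' a' = H i y (Some a)"
      using H_loc[OF iy a'] by (elim exE conjE)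
    have "H i y' (Some a) = H i y (Some a)" if "y' \<in> D_set K B (B - {i})" "near B G y y'" for y'
      by (rule G(2)[rule_format, OF that(1) a' that(2)]) simp
    then show ?thesis using G(1) by (intro exI[of _ G] conjI ballI impI)
  qed
  define T where "T i y = {m. H i y (Some (s m)) \<noteq> H i y None}" for i y
  \<comment> \<open>Subtracting the limit \<open>H i y None\<close> makes the sum over the sequence
    finite; by \<open>H_sum_None\<close> these limits add up to 0 over \<open>i\<close>.\<close>
  define S where "S i y = (\<Sum>m\<in>T i y. H i y (Some (s m)) + H i y None)" for i y
  have s_K: "s m \<in> K p" for m using s(2) by blast
  have S_eq: "S i y = (\<Sum>m\<in>M. H i y (Some (s m)) + H i y None)" if "finite M" "T i y \<subseteq> M" for i y M
    unfolding S_def using that by (intro sum.mono_neutral_left) (auto simp: T_def simp del: bit_not_zero_iff)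
  have S_loc: "loc_const B (D_set K B (B - {i})) (S i)" if i: "i \<in> B" for i
  proof (rule loc_constI)
    fix y assume y: "y \<in> D_set K B (B - {i})"
    obtain G where G: "finite G" "\<forall>y'\<in>D_set K B (B - {i}). \<forall>a'\<in>insert None (Some ` K p). near B G y y' \<longrightarrow>
        a' \<notin> Some ` G \<longrightarrow> H i y' a' = H i y None"
      using H_loc_None[OF i y] by (elim exE conjE)
    define M where "M = s -` G"
    have M: "finite M" unfolding M_def using G(1) s(1) by (rule finite_vimageI)
    have T_M: "T i y' \<subseteq> M" if "y' \<in> D_set K B (B - {i})" "near B G y y'" for y'
    proof
      fix m assume m: "m \<in> T i y'"
      have "H i y' None = H i y None" using G(2) that by blast
      moreover have "s m \<notin> G \<Longrightarrow> H i y' (Some (s m)) = H i y None" using G(2) that s_K by blast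
      ultimately show "m \<in> M" using m by (auto simp: T_def M_def)
    qed
    have "\<forall>m. \<exists>F. finite F \<and> (\<forall>y'\<in>D_set K B (B - {i}). near B F y y' \<longrightarrow> H i y' (Some (s m)) = H i y (Some (s m)))"
      using H_loc_Some[OF i y s_K] by (rule allI)
    from choice[OF this] obtain F where F: "\<forall>m. finite (F m) \<and>
        (\<forall>y'\<in>D_set K B (B - {i}). near B (F m) y y' \<longrightarrow> H i y' (Some (s m)) = H i y (Some (s m)))" ..
    \<comment> \<open>Avoiding \<open>G\<close> confines all nearby \<open>T i y'\<close> to
      \<open>M\<close>; the sets \<open>F m\<close> then fix the finitely many remaining
      terms.\<close>
    define E where "E = G \<union> (\<Union>m\<in>M. F m)"
    have "S i y' = S i y" if y': "y' \<in> D_set K B (B - {i})" and near: "near B E y y'" for y'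
    proof -
      have nG: "near B G y y'" by (rule near_mono[OF near]) (auto simp: E_def)
      have "H i y' (Some (s m)) = H i y (Some (s m))" if "m \<in> M" for m
      proof -
        have "near B (F m) y y'" by (rule near_mono[OF near]) (use that in \<open>auto simp: E_def\<close>)
        then show ?thesis using F y' by blast
      qed
      moreover have "H i y' None = H i y None" using G(2) y' nG by blast
      ultimately show ?thesis
        using S_eq[OF M T_M[OF y' nG]] S_eq[OF M T_M[OF y near_refl]] by simp
    qed
    moreover have "finite E" using G(1) M F by (simp add: E_def)
    ultimately show "\<exists>F. finite F \<and> (\<forall>y'\<in>D_set K B (B - {i}). near B F y y' \<longrightarrow> S i y' = S i y)"
      by (intro exI[of _ E] conjI ballI impI)
  qed
  have T_fin: "finite (T i y)" if i: "i \<in> B" and y: "y \<in> D_set K B (B - {i})" for i y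
  proof -
    obtain G where G: "finite G" "\<forall>y'\<in>D_set K B (B - {i}). \<forall>a'\<in>insert None (Some ` K p). near B G y y' \<longrightarrow>
        a' \<notin> Some ` G \<longrightarrow> H i y' a' = H i y None"
      using H_loc_None[OF i y] by (elim exE conjE)
    have "T i y \<subseteq> s -` G"
    proof
      fix m assume "m \<in> T i y"
      moreover have "s m \<notin> G \<Longrightarrow> H i y (Some (s m)) = H i y None"
        using G(2) y near_refl s_K by blast
      ultimately show "m \<in> s -` G" by (auto simp: T_def)
    qed
    then show ?thesis using finite_vimageI[OF G(1) s(1)] finite_subset by blast
  qed
  have "top_coboundary K B (\<lambda>y. f y + \<psi> (s 0) y)"
    unfolding top_coboundary_iff[OF finite_B]
  proof (intro exI[of _ S] conjI ballI S_loc)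
    fix y assume y: "y \<in> D_set K B B"
    have yi: "y \<in> D_set K B (B - {i})" for i using y by (auto simp: D_set_def)
    let ?N = "(\<Union>i\<in>B. T i y) \<union> {m. \<psi> (s m) y \<noteq> f y}"
    have "{m. \<psi> (s m) y \<noteq> f y} \<subseteq> s -` {a \<in> K p. \<psi> a y \<noteq> f y}" using s_K by auto
    then have "finite {m. \<psi> (s m) y \<noteq> f y}"
      using finite_vimageI[OF \<psi>[OF y] s(1)] finite_subset by blast
    then have "finite ?N" using finite_B T_fin[OF _ yi] by simp
    \<comment> \<open>The index \<open>M\<close> itself is not exceptional, so the telescoping sum
      ends with \<open>\<psi> (s M) y = f y\<close>.\<close>
    then obtain M where M: "?N \<subseteq> {..<M}" using finite_nat_set_iff_bounded by (metis lessThan_iff subsetI)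
    have "(\<Sum>i\<in>B. S i y) = (\<Sum>i\<in>B. \<Sum>m<M. H i y (Some (s m)) + H i y None)"
      using M by (intro sum.cong refl S_eq) auto
    also have "\<dots> = (\<Sum>m<M. \<Sum>i\<in>B. H i y (Some (s m)) + H i y None)" by (rule sum.swap)
    also have "\<dots> = (\<Sum>m<M. d (s m) y)"
      by (simp only: sum.distrib H_sum_Some[OF y s_K] H_sum_None[OF y] add_0_right)
    also have "\<dots> = \<psi> (s M) y + \<psi> (s 0) y"
      by (induction M) (simp_all add: d_def \<theta>_s add_ac)
    also have "\<psi> (s M) y = f y" using M by auto
    finally show "f y + \<psi> (s 0) y = (\<Sum>i\<in>B. S i y)" by simp
  qed
  from top_coboundary_add[OF finite_B this \<psi>_cob[OF s_K[of 0]]]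
  show ?thesis by (simp add: add_ac)
qed

end

section \<open>Reduction to the least infinite factor\<close>

theorem theorem3:
  fixes K :: "nat \<Rightarrow> 'k set"
    and n k :: nat
    and B :: "nat set"
    and \<phi> :: "(nat \<Rightarrow> 'k option) \<Rightarrow> ((nat \<Rightarrow> 'k option) \<Rightarrow> bit)"
  assumes "\<forall>i j. i \<le> j \<and> j \<le> n \<longrightarrow> K i \<lesssim> K j"
    and "k \<le> n"
    and "B \<subseteq> {0..n}" and "card B = k + 1"
    and "continuous_map (X_space K ({0..n} - B)) (top_cocycles K B) \<phi>"
    and "\<forall>x \<in> topspace (X_space K ({0..n} - B)) - {X_infinity ({0..n} - B)}. top_coboundary K B (\<phi> x)"
    and "\<not> top_coboundary K B (\<phi> (X_infinity ({0..n} - B)))"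
  shows "carrier (sheaf_cohomology_Z2 (X_punctured K {0..n}) k)
           \<noteq> {\<one>\<^bsub>sheaf_cohomology_Z2 (X_punctured K {0..n}) k\<^esub>}"
proof
  let ?J = "{0..n} - B"
  assume triv: "carrier (sheaf_cohomology_Z2 (X_punctured K {0..n}) k)
           = {\<one>\<^bsub>sheaf_cohomology_Z2 (X_punctured K {0..n}) k\<^esub>}"
  have finB: "finite B" using assms(3) finite_subset by blast
  have infB: "infinite (K b)" if "b \<in> B" for b
    using top_coboundary_if_finite[OF finB that] assms(7) by blast
  obtain b0 where b0: "b0 \<in> B" using assms(4) by fastforce
  have "k > 0"
  proof (rule ccontr)
    assume "\<not> k > 0"
    then have k: "k = 0" by simp
    obtain a where a: "a \<in> K b0" using infB[OF b0] by fastforce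
    let ?x = "\<lambda>i\<in>{0..n}. if i = b0 then Some a else None"
    have "?x \<in> topspace (X_punctured K {0..n})"
    proof -
      have "?x b0 \<noteq> X_infinity {0..n} b0" using b0 assms(3) by (auto simp: X_infinity_def)
      then have "?x \<noteq> X_infinity {0..n}" by metis
      then show ?thesis using a by (auto simp: topspace_X_punctured topspace_X_space)
    qed
    then have "topspace (X_punctured K {0..n}) \<noteq> {}" by blast
    from sheaf_cohomology_zero_nontrivial[OF this] triv k show False by simp
  qed
  define p where "p = (LEAST p. infinite (K p))"
  have p: "infinite (K p)" unfolding p_def using infB[OF b0] by (rule LeastI)
  have p_least: "p \<le> j" if "infinite (K j)" for j unfolding p_def using that by (rule Least_le)
  have "\<exists>\<iota>. inj_on \<iota> (K p) \<and> \<iota> ` K p \<subseteq> K j \<and> (j = p \<longrightarrow> (\<forall>a. \<iota> a = a))" if "p \<le> j" "j \<le> n" for j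
  proof (cases "j = p")
    case True
    then show ?thesis by (intro exI[of _ "\<lambda>a. a"]) auto
  next
    case False
    then show ?thesis using assms(1) that unfolding lepoll_def by blast
  qed
  then obtain \<iota> where \<iota>: "\<And>j. p \<le> j \<Longrightarrow> j \<le> n \<Longrightarrow>
      inj_on (\<iota> j) (K p) \<and> \<iota> j ` K p \<subseteq> K j \<and> (j = p \<longrightarrow> (\<forall>a. \<iota> j a = a))" by metis
  have pn: "p \<le> n" using p_least[OF infB[OF b0]] b0 assms(3) by auto
  interpret diagonal K n p B \<iota>
  proof
    show "B \<subseteq> {p..n}" using p_least infB assms(3) by auto
    show "finite (K j)" if "j < p" for j using p_least[of j] that by (meson not_le)
  qed (use \<iota> pn in \<open>auto simp: image_subset_iff\<close>)
  have card: "card B = Suc k" using assms(4) by simp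
  have "top_coboundary K B (\<phi> (X_infinity ?J))"
  proof (cases "p \<in> B")
    case True
    then show ?thesis by (rule top_coboundary_if_mem[OF triv \<open>k > 0\<close> card])
  next
    case False
    then have pJ: "p \<in> ?J" using pn by simp
    \<comment> \<open>These points differ from infinity only in the coordinate \<open>p\<close> and
      converge to it, so (1) applies to each of them.\<close>
    define z where "z a = (\<lambda>i\<in>?J. if i = p then Some a else None)" for a :: 'k
    have z: "z a \<in> topspace (X_space K ?J) - {X_infinity ?J}" if "a \<in> K p" for a
    proof -
      have "z a p \<noteq> X_infinity ?J p" using pJ by (simp add: z_def X_infinity_def)
      then have "z a \<noteq> X_infinity ?J" by metis
      then show ?thesis using that by (auto simp: z_def topspace_X_space)
    qed
    show ?thesis
    proof (rule top_coboundary_limit[OF triv \<open>k > 0\<close> card False p])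
      show "top_coboundary K B (\<phi> (z a))" if "a \<in> K p" for a using assms(6) z[OF that] by blast
      fix y assume y: "y \<in> D_set K B B"
      \<comment> \<open>Convergence of cocycles is pointwise, so for fixed \<open>y\<close> the
        values \<open>\<phi> (z a) y\<close> equal the limit for all but finitely many
        \<open>a\<close>.\<close>
      have "continuous_map (X_space K ?J) (discrete_topology UNIV) (\<lambda>x. \<phi> x y)"
        using assms(5) y unfolding top_cocycles_def by (simp add: continuous_map_componentwise)
      then have "loc_const ?J (topspace (X_space K ?J)) (\<lambda>x. \<phi> x y)"
        by (subst continuous_map_iff_loc_const[symmetric]) auto
      moreover have "X_infinity ?J \<in> topspace (X_space K ?J)"
        by (simp add: X_infinity_def topspace_X_space)
      ultimately obtain F where F: "finite F" "\<forall>x\<in>topspace (X_space K ?J).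
          near ?J F (X_infinity ?J) x \<longrightarrow> \<phi> x y = \<phi> (X_infinity ?J) y"
        by (rule loc_constD)
      have "a \<in> F" if a: "a \<in> K p" "\<phi> (z a) y \<noteq> \<phi> (X_infinity ?J) y" for a
      proof (rule ccontr)
        assume "a \<notin> F"
        then have "near ?J F (X_infinity ?J) (z a)" by (auto simp: near_def z_def X_infinity_def)
        then show False using F(2) z[OF a(1)] a(2) by blast
      qed
      then show "finite {a \<in> K p. \<phi> (z a) y \<noteq> \<phi> (X_infinity ?J) y}"
        by (intro finite_subset[OF _ F(1)]) auto
    qed
  qed
  with assms(7) show False by blast
qed

end
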